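(* Let $\{\varphi^t\}_{t\ge0}$ be the discrete-time dynamical system generated by a continuously differentiable map $\varphi:U\subseteq\mathbb{R}^n\to U$ with $\det D\varphi(u)\neq0$ for all $u\in U$, and let $K\subset U$ be a nonempty compact invariant set. Suppose there exist an integer $j\in\{1,\dots,n-1\}$, a real $s\in[0,1]$, a continuous scalar function $V:K\to\mathbb{R}$, and a nonsingular $n\times n$ matrix $S$ such that $$\sup_{u\in K}\Big(\ln\lambda_1(u,S)+\cdots+\ln\lambda_j(u,S)+s\ln\lambda_{j+1}(u,S)+\big(V(\varphi(u))-V(u)\big)\Big)<0,$$ where $\lambda_1(u,S)\ge\cdots\ge\lambda_n(u,S)>0$ are the singular values of the matrix $S\,D\varphi(u)\,S^{-1}$ (i.e. the positive square roots of the eigenvalues of $(S\,D\varphi(u)\,S^{-1})^*\,S\,D\varphi(u)\,S^{-1}$). Then $$\dim_{\rm H}K\le\dim_{\rm L}(\{\varphi^t\}_{t\ge0},K)\le\dim_{\rm L}(\varphi^T,K)<j+s$$ for all sufficiently large (integer) $T>0$.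
   Context: $U\subseteq\mathbb{R}^n$ is open. $\varphi^t$, $t=0,1,2,\dots$, is the $t$-fold iterate of $\varphi$, with $\varphi^0={\rm id}$; $D\varphi^t(u)$ is its $n\times n$ Jacobian matrix at $u$. A set $K$ is invariant if $\varphi^t(K)=K$ for all $t>0$. $\dim_{\rm H}$ is the Hausdorff dimension. All times are integers. Singular value function. For a nonsingular $n\times n$ matrix $A$ with singular values $\sigma_1\ge\dots\ge\sigma_n>0$ and $d\in[0,n]$: $\omega_0(A)=1$; $\omega_d(A)=\sigma_1\cdots\sigma_d$ for $d\in\{1,\dots,n\}$; $\omega_d(A)=\sigma_1\cdots\sigma_{\lfloor d\rfloor}\,\sigma_{\lfloor d\rfloor+1}^{\,d-\lfloor d\rfloor}$ for non-integer $d\in(0,n)$. Lyapunov dimensions. $\dim_{\rm L}(\varphi^t,u)=\inf\{d\in[0,n]:\omega_d(D\varphi^t(u))<1\}$, with the value $n$ if this set is empty; $\dim_{\rm L}(\varphi^t,K)=\sup_{u\in K}\dim_{\rm L}(\varphi^t,u)$; $\dim_{\rm L}(\{\varphi^t\}_{t\ge0},K)=\inf_{t>0}\dim_{\rm L}(\varphi^t,K)$. *)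

theory Defs
  imports "HOL-Analysis.Analysis" "HOL-Computational_Algebra.Computational_Algebra"
begin

definition charpoly :: "real^'n^'n \<Rightarrow> real poly" where
  "charpoly A = det (mat [:0, 1:] - map_matrix (\<lambda>c. [:c:]) A)"

text \<open>The real eigenvalues in decreasing order, repeated according to their algebraic
  multiplicity. The list has full length \<open>CARD('n)\<close> when \<open>A\<close> is symmetric, which is the only
  case used below.\<close>

definition eigvals :: "real^'n^'n \<Rightarrow> real list" where
  "eigvals A = rev (sorted_list_of_multiset (proots (charpoly A)))"

text \<open>Singular values are indexed from 1, so \<open>singular_value A 1\<close> is the largest one; the value
  is unspecified for indices outside \<open>{1..CARD('n)}\<close>.\<close>

definition singular_value :: "real^'n^'n \<Rightarrow> nat \<Rightarrow> real" where
  "singular_value A i = sqrt (eigvals (transpose A ** A) ! (i - 1))"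

text \<open>For \<open>d = 0\<close> the product is empty. The case distinction keeps \<open>singular_value A (n + 1)\<close>
  from occurring when \<open>d = n\<close> is the dimension.\<close>

definition sv_function :: "real \<Rightarrow> real^'n^'n \<Rightarrow> real" where
  "sv_function d A =
     (if d \<in> \<int> then (\<Prod>i = 1..nat \<lfloor>d\<rfloor>. singular_value A i)
      else (\<Prod>i = 1..nat \<lfloor>d\<rfloor>. singular_value A i) *
           singular_value A (nat \<lfloor>d\<rfloor> + 1) powr (d - of_int \<lfloor>d\<rfloor>))"

text \<open>The first argument of the next two definitions is a single map, such as an iterate
  \<open>\<phi> ^^ t\<close>.\<close>

definition local_lyapunov_dim :: "(real^'n \<Rightarrow> real^'n) \<Rightarrow> real^'n \<Rightarrow> real" where
  "local_lyapunov_dim f u =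
     (let D = {d \<in> {0..real CARD('n)}. sv_function d (jacobian f (at u)) < 1}
      in if D = {} then real CARD('n) else Inf D)"

definition lyapunov_dim :: "(real^'n \<Rightarrow> real^'n) \<Rightarrow> (real^'n) set \<Rightarrow> real" where
  "lyapunov_dim f K = (SUP u\<in>K. local_lyapunov_dim f u)"

definition system_lyapunov_dim :: "(real^'n \<Rightarrow> real^'n) \<Rightarrow> (real^'n) set \<Rightarrow> real" where
  "system_lyapunov_dim \<phi> K = (INF t\<in>{0::nat<..}. lyapunov_dim (\<phi> ^^ t) K)"

text \<open>The \<open>s\<close>-th power of the diameter, with the conventions that the empty set always
  contributes \<open>0\<close> and that \<open>0\<^sup>0 = 1\<close> for nonempty sets (whereas \<open>0 powr 0 = 0\<close>).\<close>

definition diam_pow :: "real \<Rightarrow> 'a::metric_space set \<Rightarrow> real" where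
  "diam_pow s C = (if C = {} then 0 else if s = 0 then 1 else diameter C powr s)"

text \<open>Boundedness is required since \<open>diameter\<close> is meaningless on unbounded sets.\<close>

definition hausdorff_premeasure :: "real \<Rightarrow> real \<Rightarrow> 'a::metric_space set \<Rightarrow> ennreal" where
  "hausdorff_premeasure s \<delta> E =
     (INF C \<in> {C :: nat \<Rightarrow> 'a set. E \<subseteq> (\<Union>i. C i) \<and> (\<forall>i. bounded (C i) \<and> diameter (C i) \<le> \<delta>)}.
        \<Sum>i. ennreal (diam_pow s (C i)))"

definition hausdorff_measure :: "real \<Rightarrow> 'a::metric_space set \<Rightarrow> ennreal" where
  "hausdorff_measure s E = (SUP \<delta>\<in>{0<..}. hausdorff_premeasure s \<delta> E)"

definition hausdorff_dim :: "'a::metric_space set \<Rightarrow> ereal" where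
  "hausdorff_dim E = (INF s\<in>{s. 0 \<le> s \<and> hausdorff_measure s E = 0}. ereal s)"

end

theory Submission
  imports Defs
begin

text \<open>The singular value function is submultiplicative (Horn), because products of singular values
  are maximal volume expansions and hence maximal Gram determinants. Along an orbit the cocycle
  \<open>S D\<phi> S\<^sup>-\<^sup>1\<close> with weight \<open>V\<close> therefore satisfies
  \<open>ln \<omega>\<^sub>d(D\<phi>\<^sup>T) \<le> C - \<epsilon>T\<close> for \<open>d = j + s\<close>, since the contributions of \<open>V\<close> telescope and those
  of \<open>S\<close> are bounded. The upper bound on the Hausdorff dimension is the theorem of Douady and
  Oesterle: a high iterate maps a ball of radius \<open>r\<close> into a thin ellipsoid, which is covered by
  so few balls that the sum of the \<open>d\<close>-th powers of the radii is halved; iterating this on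
  a finite cover of \<open>K\<close> makes its \<open>d\<close>-dimensional measure vanish.\<close>

section \<open>Singular values\<close>

text \<open>Singular values are defined by roots of a characteristic polynomial, so the geometry
  rests on an orthonormal basis with orthogonal images that realises these roots with multiplicity.
  Only integer exponents are volumes; for real d the logarithm of omega_d interpolates linearly
  between neighbouring integers, which carries submultiplicativity over. Pointwise strict
  inequalities must become uniform on \<open>K\<close>. For the Hausdorff bound this is a
  multiplicative perturbation estimate and compactness. For the strict bound on
  \<open>lyapunov_dim\<close>, a supremum, the nonvanishing determinant gives a positive lower bound
  c on the expansion of the Jacobians over \<open>K\<close>, and so d can be lowered by one fixed
  amount. Such a c is also the tolerance for the nonlinear error: it lies below every singular
  value, so the error at most doubles the half-axes of the ellipsoid. The covering argument needs d
  < n, since it uses the singular value number floor(d) + 1. When the Lyapunov dimension is n, a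
  grid count for bounded sets replaces it.\<close>

lemma linear_term_eq_0_if_dominated:
  fixes b c :: real
  assumes "\<And>t. 2 * t * b \<le> t\<^sup>2 * c"
  shows "b = 0"
proof (rule ccontr)
  assume b: "b \<noteq> 0"
  \<comment> \<open>\<open>c\<close> may be zero or negative, so \<open>\<bar>c\<bar> + 1\<close>
    replaces it; this \<open>t\<close> makes the right-hand side at most \<open>t * b\<close>, half
    of the left-hand side.\<close>
  define t where "t = b / (\<bar>c\<bar> + 1)"
  have "2 * t * b \<le> t\<^sup>2 * c" by (rule assms)
  also have "\<dots> \<le> t\<^sup>2 * (\<bar>c\<bar> + 1)" by (intro mult_left_mono) auto
  also have "\<dots> = t * b" by (simp add: t_def power2_eq_square)
  finally have "t * b \<le> 0" by linarith
  moreover have "t * b > 0" using b by (simp add: t_def zero_less_mult_iff zero_less_divide_iff) linarith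
  ultimately show False by simp
qed

text \<open>Maximise \<open>norm (f x)\<close> on the unit sphere of \<open>V\<close>: first-order optimality makes \<open>f\<close> of the
  orthogonal complement orthogonal to \<open>f x\<close>.\<close>

lemma orthonormal_basis_orthogonal_images:
  fixes f :: "'a::euclidean_space \<Rightarrow> 'b::real_inner"
  assumes f: "linear f" and "subspace V"
  obtains B where "finite B" "B \<subseteq> V" "pairwise orthogonal B" "\<And>x. x \<in> B \<Longrightarrow> norm x = 1"
    "span B = V" "pairwise (\<lambda>x y. f x \<bullet> f y = 0) B"
proof -
  have cont: "continuous_on UNIV f"
    using f by (simp add: linear_conv_bounded_linear linear_continuous_on)
  have "\<exists>B. finite B \<and> B \<subseteq> V \<and> pairwise orthogonal B \<and> (\<forall>x\<in>B. norm x = 1)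
      \<and> span B = V \<and> pairwise (\<lambda>x y. f x \<bullet> f y = 0) B"
    using \<open>subspace V\<close>
  proof (induction "dim V" arbitrary: V rule: less_induct)
    case less
    show ?case
    proof (cases "V \<subseteq> {0}")
      case True
      then have "V = {0}" using subspace_0[OF less.prems] by auto
      then show ?thesis by (intro exI[of _ "{}"]) auto
    next
      case False
      then obtain v where v: "v \<in> V" "v \<noteq> 0" by auto
      let ?C = "sphere 0 1 \<inter> V"
      have "v /\<^sub>R norm v \<in> ?C" using v less.prems by (auto intro: subspace_scale)
      moreover have "compact ?C"
        by (simp add: less.prems closed_subspace compact_Int_closed)
      moreover have "continuous_on ?C (\<lambda>x. f x \<bullet> f x)"
        by (intro continuous_intros continuous_on_subset[OF cont]) auto
      ultimately obtain x where x: "x \<in> ?C" and max: "\<And>y. y \<in> ?C \<Longrightarrow> f y \<bullet> f y \<le> f x \<bullet> f x"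
        using continuous_attains_sup[of ?C "\<lambda>x. f x \<bullet> f x"] by blast
      then have x1: "norm x = 1" "x \<in> V" "x \<bullet> x = 1" by (auto simp: norm_eq_1)
      have max': "f y \<bullet> f y \<le> (f x \<bullet> f x) * (y \<bullet> y)" if "y \<in> V" for y
      proof (cases "y = 0")
        case True then show ?thesis using linear_0[OF f] by simp
      next
        case False
        then have "y /\<^sub>R norm y \<in> ?C" using that less.prems by (auto intro: subspace_scale)
        from max[OF this] have "(f y \<bullet> f y) / (norm y)\<^sup>2 \<le> f x \<bullet> f x"
          by (simp add: linear_scale[OF f] power2_eq_square divide_inverse ac_simps)
        then show ?thesis using False by (simp add: field_simps power2_norm_eq_inner)
      qed
      have orth: "f x \<bullet> f y = 0" if "y \<in> V" "x \<bullet> y = 0" for y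
      proof (rule linear_term_eq_0_if_dominated)
        fix t :: real
        \<comment> \<open>When \<open>max'\<close> is applied to x + t y, the constant terms on both
          sides agree because x is a unit vector orthogonal to y; only the linear and quadratic
          terms in t remain.\<close>
        have "x + t *\<^sub>R y \<in> V" using x1 that less.prems by (intro subspace_add subspace_scale)
        from max'[OF this] show "2 * t * (f x \<bullet> f y) \<le> t\<^sup>2 * ((f x \<bullet> f x) * (y \<bullet> y) - f y \<bullet> f y)"
          using x1 that by (simp add: linear_add[OF f] linear_scale[OF f] inner_simps
              inner_commute algebra_simps power2_eq_square)
      qed
      define W where "W = V \<inter> {y. orthogonal x y}"
      have W: "subspace W" "W \<subseteq> V" unfolding W_def
        by (auto intro: subspace_inter less.prems subspace_orthogonal_to_vector)
      have "x \<notin> W" using x1 by (auto simp: W_def orthogonal_def)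
      then have "W \<subset> V" using x1 W by blast
      then have "dim W < dim V"
        by (intro dim_psubset) (metis W(1) less.prems span_eq_iff)
      from less.hyps[OF this W(1)] obtain B where B: "finite B" "B \<subseteq> W" "pairwise orthogonal B"
        "\<forall>x\<in>B. norm x = 1" "span B = W" "pairwise (\<lambda>x y. f x \<bullet> f y = 0) B" by auto
      have "V \<subseteq> span (insert x B)"
      proof
        fix y assume y: "y \<in> V"
        have "y - (x \<bullet> y) *\<^sub>R x \<in> W" unfolding W_def using y x1 less.prems
          by (auto simp: orthogonal_def inner_simps intro: subspace_diff subspace_scale)
        then have "y - (x \<bullet> y) *\<^sub>R x \<in> span (insert x B)" using B(5) span_mono by blast
        then show "y \<in> span (insert x B)"
          by (metis diff_add_cancel insertI1 span_add span_base span_scale)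
      qed
      moreover have "span (insert x B) \<subseteq> V"
        using W B x1 less.prems by (intro span_minimal) auto
      moreover have "pairwise orthogonal (insert x B)"
        using B(2,3) by (auto simp: pairwise_insert W_def orthogonal_commute)
      moreover have "pairwise (\<lambda>x y. f x \<bullet> f y = 0) (insert x B)"
        using B(2,6) orth by (auto simp: pairwise_insert W_def orthogonal_def inner_commute)
      ultimately show ?thesis using B x1 W by (intro exI[of _ "insert x B"]) auto
    qed
  qed
  then show ?thesis using that by blast
qed

text \<open>Families instead of sets, because the frames below are numbered either by
  \<open>1..k\<close> (ordered singular vectors) or by subsets of the type \<open>'n\<close> (Gram
  determinants).\<close>

definition orthonormal_on :: "'i set \<Rightarrow> ('i \<Rightarrow> 'a::real_inner) \<Rightarrow> bool" where
  "orthonormal_on I e \<longleftrightarrow> (\<forall>i\<in>I. \<forall>j\<in>I. e i \<bullet> e j = (if i = j then 1 else 0))"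

lemma orthonormal_onD:
  "orthonormal_on I e \<Longrightarrow> i \<in> I \<Longrightarrow> j \<in> I \<Longrightarrow> e i \<bullet> e j = (if i = j then 1 else 0)"
  by (simp add: orthonormal_on_def)

lemma orthonormal_on_norm: "orthonormal_on I e \<Longrightarrow> i \<in> I \<Longrightarrow> norm (e i) = 1"
  by (simp add: orthonormal_on_def norm_eq_1)

lemma orthonormal_on_inj: "orthonormal_on I e \<Longrightarrow> inj_on e I"
  by (auto simp: orthonormal_on_def inj_on_def) (metis zero_neq_one)

lemma orthonormal_on_subset: "orthonormal_on I e \<Longrightarrow> J \<subseteq> I \<Longrightarrow> orthonormal_on J e"
  by (auto simp: orthonormal_on_def subset_iff)

lemma orthonormal_on_independent:
  assumes "orthonormal_on I e" shows "independent (e ` I)"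
proof (rule pairwise_orthogonal_independent)
  show "pairwise orthogonal (e ` I)" using assms
    by (auto simp: pairwise_def orthogonal_def orthonormal_on_def)
  show "0 \<notin> e ` I" using orthonormal_on_norm[OF assms] by force
qed

lemma orthonormal_on_dim_span:
  fixes e :: "'i \<Rightarrow> 'a::euclidean_space"
  assumes "orthonormal_on I e" "finite I" shows "dim (span (e ` I)) = card I"
  using orthonormal_on_independent[OF assms(1)] orthonormal_on_inj[OF assms(1)]
  by (simp add: dim_eq_card_independent card_image)

lemma orthonormal_on_expand:
  assumes e: "orthonormal_on I e" "finite I" and x: "x \<in> span (e ` I)"
  shows "x = (\<Sum>i\<in>I. (e i \<bullet> x) *\<^sub>R e i)"
proof -
  from x e(2) have "\<exists>c. x = (\<Sum>i\<in>I. c i *\<^sub>R e i)"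
    using orthonormal_on_inj[OF e(1)] by (auto simp: span_finite sum.reindex)
  then obtain c where c: "x = (\<Sum>i\<in>I. c i *\<^sub>R e i)" by blast
  have "e i \<bullet> x = c i" if "i \<in> I" for i
  proof -
    have "e i \<bullet> x = (\<Sum>l\<in>I. c l * (if i = l then 1 else 0))"
      unfolding c inner_sum_right using orthonormal_onD[OF e(1) that] by (intro sum.cong) auto
    then show ?thesis using that e(2) by (simp add: if_distrib cong: if_cong)
  qed
  then show ?thesis using c by (simp cong: sum.cong)
qed

lemma inner_orthonormal_sums:
  assumes e: "orthonormal_on I e" "finite I" 
  shows "(\<Sum>i\<in>I. c i *\<^sub>R e i) \<bullet> (\<Sum>i\<in>I. d i *\<^sub>R e i) = (\<Sum>i\<in>I. c i * d i)"
proof -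
  have "(\<Sum>i\<in>I. c i *\<^sub>R e i) \<bullet> (\<Sum>i\<in>I. d i *\<^sub>R e i) =
      (\<Sum>i\<in>I. \<Sum>l\<in>I. c i * d l * (if i = l then 1 else 0))"
    unfolding inner_sum_left inner_sum_right using orthonormal_onD[OF e(1)]
    by (intro sum.cong) auto
  then show ?thesis using e(2) by (simp add: if_distrib cong: if_cong)
qed

text \<open>The right singular vectors of the restriction of \<open>f\<close> to \<open>V\<close>,
  in decreasing order and numbered from 1 like \<open>singular_value\<close>. The whole space gives
  the decomposition of a matrix, proper subspaces give the frames compared by interlacing.\<close>

lemma ordered_singular_basis:
  fixes f :: "'a::euclidean_space \<Rightarrow> 'b::real_inner"
  assumes f: "linear f" and "subspace V"
  obtains w :: "nat \<Rightarrow> 'a" where "orthonormal_on {1..dim V} w" "span (w ` {1..dim V}) = V"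
    "\<And>i j. i \<in> {1..dim V} \<Longrightarrow> j \<in> {1..dim V} \<Longrightarrow> i \<noteq> j \<Longrightarrow> f (w i) \<bullet> f (w j) = 0"
    "\<And>i j. 1 \<le> i \<Longrightarrow> i \<le> j \<Longrightarrow> j \<le> dim V \<Longrightarrow> norm (f (w j)) \<le> norm (f (w i))"
proof -
  from orthonormal_basis_orthogonal_images[OF assms] obtain B where
    B: "finite B" "B \<subseteq> V" "pairwise orthogonal B" "\<And>x. x \<in> B \<Longrightarrow> norm x = 1"
      "span B = V" "pairwise (\<lambda>x y. f x \<bullet> f y = 0) B" by metis
  have "independent B" using B(3,4) by (intro pairwise_orthogonal_independent) force+
  then have card: "card B = dim V" using B(5) by (metis dim_eq_card_independent dim_span)
  obtain xs where xs: "set xs = B" "distinct xs" using finite_distinct_list[OF B(1)] by blast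
  define ys where "ys = rev (sort_key (\<lambda>x. norm (f x)) xs)"
  have ys: "set ys = B" "distinct ys" "length ys = dim V"
    using xs card by (auto simp: ys_def distinct_card[symmetric])
  define w where "w i = ys ! (i - 1)" for i
  have inB: "w i \<in> B" if "i \<in> {1..dim V}" for i
    using that ys by (auto simp: w_def nth_mem)
  have inj: "w i \<noteq> w j" if "i \<in> {1..dim V}" "j \<in> {1..dim V}" "i \<noteq> j" for i j
    using that ys by (auto simp: w_def nth_eq_iff_index_eq)
  have img: "w ` {1..dim V} = B"
  proof
    show "B \<subseteq> w ` {1..dim V}"
    proof
      fix b assume "b \<in> B"
      then obtain i where "i < dim V" "b = ys ! i" using ys by (metis in_set_conv_nth)
      then show "b \<in> w ` {1..dim V}" by (intro image_eqI[of _ _ "Suc i"]) (auto simp: w_def)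
    qed
  qed (use inB in auto)
  show thesis
  proof (rule that)
    show "orthonormal_on {1..dim V} w"
      unfolding orthonormal_on_def
      using B(3,4) inB inj by (auto simp: pairwise_def orthogonal_def norm_eq_1)
    show "span (w ` {1..dim V}) = V" using img B by simp
    show "f (w i) \<bullet> f (w j) = 0" if "i \<in> {1..dim V}" "j \<in> {1..dim V}" "i \<noteq> j" for i j
      using B(6) inB inj that by (auto simp: pairwise_def)
    show "norm (f (w j)) \<le> norm (f (w i))" if "1 \<le> i" "i \<le> j" "j \<le> dim V" for i j
    proof -
      have "sorted (map (\<lambda>x. norm (f x)) (rev ys))" by (simp add: ys_def)
      then have "sorted_wrt (\<ge>) (map (\<lambda>x. norm (f x)) ys)"
        by (simp add: rev_map[symmetric] sorted_wrt_rev)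
      then have "map (\<lambda>x. norm (f x)) ys ! (i-1) \<ge> map (\<lambda>x. norm (f x)) ys ! (j-1)"
        using that ys sorted_wrt_nth_less[of "(\<ge>)" "map (\<lambda>x. norm (f x)) ys" "i-1" "j-1"]
        by (cases "i = j") auto
      then show ?thesis using that ys by (simp add: w_def)
    qed
  qed
qed

section \<open>Singular values as roots of the characteristic polynomial\<close>

lemma matrix_const_poly_mult:
  fixes A B :: "real^'n^'n"
  shows "map_matrix (\<lambda>c. [:c:]) (A ** B) = map_matrix (\<lambda>c. [:c:]) A ** map_matrix (\<lambda>c. [:c:]) B"
proof -
  have "[:\<Sum>k\<in>I. f k * g k:] = (\<Sum>k\<in>I. [:f k:] * [:g k:])" for f g :: "'n \<Rightarrow> real" and I
  proof -
    have "[:a + b:] = [:a:] + [:b:]" for a b :: real by simp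
    then show ?thesis
      by (induction I rule: infinite_finite_induct) (simp_all del: add_pCons add: mult.commute)
  qed
  then show ?thesis
    by (simp add: map_matrix_def vec_eq_iff matrix_matrix_mult_def)
qed

text \<open>The similarity is carried out on matrices over the polynomial ring. That ring is an
  integral domain, so after taking determinants the nonzero factor \<open>det (?c Q)\<close>
  cancels.\<close>

lemma charpoly_orthogonal_diagonalisation:
  fixes M Q :: "real^'n^'n" and d :: "'n \<Rightarrow> real"
  assumes Q: "transpose Q ** Q = mat 1" and MQ: "M ** Q = Q ** (\<chi> i j. if i = j then d i else 0)"
  shows "charpoly M = (\<Prod>i\<in>UNIV. [:- d i, 1:])"
proof -
  let ?c = "map_matrix (\<lambda>c::real. [:c:]) :: real^'n^'n \<Rightarrow> real poly^'n^'n"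
  let ?X = "mat [:0, 1:] :: real poly^'n^'n"
  let ?D = "(\<chi> i j. if i = j then d i else 0) :: real^'n^'n"
  have one: "?c (mat 1) = mat 1" by (simp add: map_matrix_def mat_def vec_eq_iff)
  have "?c (transpose Q) ** ?c Q = mat 1" using Q one by (simp flip: matrix_const_poly_mult)
  then have "det (?c (transpose Q)) * det (?c Q) = 1" by (metis det_I det_mul)
  then have nz: "det (?c Q) \<noteq> 0" by auto
  have comm: "?X ** ?c Q = ?c Q ** ?X"
  proof -
    have "(?X ** Y) $ i $ j = [:0, 1:] * Y $ i $ j" "(Y ** ?X) $ i $ j = Y $ i $ j * [:0, 1:]"
      for Y :: "real poly^'n^'n" and i j
      by (simp_all add: matrix_matrix_mult_def mat_def if_distrib if_distribR sum.delta sum.delta'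
          del: mult_pCons_left mult_pCons_right cong: if_cong)
    then show ?thesis by (simp add: vec_eq_iff mult.commute)
  qed
  have diff_mult: "(X - Y) ** Z = X ** Z - Y ** Z" "Z ** (X - Y) = Z ** X - Z ** Y"
    for X Y Z :: "real poly^'n^'n"
    by (simp_all add: matrix_matrix_mult_def vec_eq_iff algebra_simps sum_subtractf)
  have "(?X - ?c M) ** ?c Q = ?c Q ** (?X - ?c ?D)"
    by (simp add: diff_mult comm MQ flip: matrix_const_poly_mult)
  from arg_cong[OF this, of det]
  have "det (?X - ?c M) * det (?c Q) = det (?c Q) * det (?X - ?c ?D)"
    unfolding det_mul .
  then have "charpoly M = det (?X - ?c ?D)" using nz by (simp add: charpoly_def)
  also have "\<dots> = (\<Prod>i\<in>UNIV. (?X - ?c ?D) $ i $ i)"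
    by (intro det_diagonal) (simp add: map_matrix_def mat_def)
  also have "\<dots> = (\<Prod>i\<in>UNIV. [:- d i, 1:])"
    by (simp add: map_matrix_def mat_def)
  finally show ?thesis .
qed

text \<open>The bridge from the algebraic definition to geometry; later arguments about singular
  values go through this basis and leave \<open>charpoly\<close> aside.\<close>

lemma singular_value_decomposition:
  fixes A :: "real^'n^'n"
  obtains w :: "nat \<Rightarrow> real^'n" where "orthonormal_on {1..CARD('n)} w" "span (w ` {1..CARD('n)}) = UNIV"
    "\<And>i j. i \<in> {1..CARD('n)} \<Longrightarrow> j \<in> {1..CARD('n)} \<Longrightarrow> i \<noteq> j \<Longrightarrow> (A *v w i) \<bullet> (A *v w j) = 0"
    "\<And>i. i \<in> {1..CARD('n)} \<Longrightarrow> norm (A *v w i) = singular_value A i"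
    "\<And>i j. 1 \<le> i \<Longrightarrow> i \<le> j \<Longrightarrow> j \<le> CARD('n) \<Longrightarrow> singular_value A j \<le> singular_value A i"
proof -
  let ?n = "CARD('n)" and ?f = "\<lambda>x. A *v x"
  from ordered_singular_basis[OF matrix_vector_mul_linear[of A] subspace_UNIV] obtain w :: "nat \<Rightarrow> real^'n" where
    w: "orthonormal_on {1..?n} w" "span (w ` {1..?n}) = UNIV"
      "\<And>i j. i \<in> {1..?n} \<Longrightarrow> j \<in> {1..?n} \<Longrightarrow> i \<noteq> j \<Longrightarrow> ?f (w i) \<bullet> ?f (w j) = 0"
      "\<And>i j. 1 \<le> i \<Longrightarrow> i \<le> j \<Longrightarrow> j \<le> ?n \<Longrightarrow> norm (?f (w j)) \<le> norm (?f (w i))"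
    by (simp add: dim_UNIV) metis
  \<comment> \<open>Matrices are indexed by \<open>'n\<close> but the basis by \<open>1..n\<close>;
    \<open>h\<close> lets the vectors \<open>w i\<close> become the columns of
    \<open>Q\<close>.\<close>
  obtain h where h: "bij_betw h (UNIV :: 'n set) {1..?n}"
    using finite_same_card_bij[of "UNIV :: 'n set" "{1..?n}"] by auto
  define d where "d i = (norm (A *v w i))\<^sup>2" for i
  define M where "M = transpose A ** A"
  define Q :: "real^'n^'n" where "Q = (\<chi> i j. w (h j) $ i)"
  have hin: "h i \<in> {1..?n}" for i using h by (auto simp: bij_betw_def)
  have heq: "h i = h j \<longleftrightarrow> i = j" for i j using h by (auto simp: bij_betw_def inj_on_def)
  \<comment> \<open>The coefficient of \<open>M *v w i\<close> at \<open>w l\<close> is the inner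
    product of \<open>A *v w l\<close> and \<open>A *v w i\<close>, which vanishes for distinct
    indices.\<close>
  have eig: "M *v w i = d i *\<^sub>R w i" if i: "i \<in> {1..?n}" for i
  proof -
    have "M *v w i = (\<Sum>l=1..?n. (w l \<bullet> (M *v w i)) *\<^sub>R w l)"
      using w(1,2) by (intro orthonormal_on_expand) auto
    also have "\<dots> = (\<Sum>l=1..?n. (if l = i then d i else 0) *\<^sub>R w l)"
    proof (intro sum.cong refl)
      fix l assume l: "l \<in> {1..?n}"
      have "w l \<bullet> (M *v w i) = (A *v w l) \<bullet> (A *v w i)"
        by (simp add: M_def dot_lmul_matrix[symmetric] matrix_vector_mul_assoc[symmetric] 
             flip: transpose_matrix_vector) 
      also have "\<dots> = (if l = i then d i else 0)"
        using w(3)[OF l i] by (auto simp: d_def power2_norm_eq_inner)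
      finally show "(w l \<bullet> (M *v w i)) *\<^sub>R w l = (if l = i then d i else 0) *\<^sub>R w l" by simp
    qed
    also have "\<dots> = d i *\<^sub>R w i" using i by (simp add: if_distrib if_distribR sum.delta cong: if_cong)
    finally show ?thesis .
  qed
  have "transpose Q ** Q = mat 1"
  proof -
    have "(transpose Q ** Q) $ i $ j = w (h i) \<bullet> w (h j)" for i j
      by (simp add: matrix_matrix_mult_def transpose_def Q_def inner_vec_def)
    then show ?thesis using orthonormal_onD[OF w(1) hin hin] by (simp add: vec_eq_iff mat_def heq)
  qed
  moreover have "M ** Q = Q ** (\<chi> i j. if i = j then d (h i) else 0)"
  proof -
    have "(M ** Q) $ i $ j = (M *v w (h j)) $ i" for i j
      by (simp add: matrix_matrix_mult_def matrix_vector_mult_def Q_def)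
    then show ?thesis using eig[OF hin]
      by (simp add: vec_eq_iff matrix_matrix_mult_def Q_def if_distrib sum.delta cong: if_cong)
  qed
  ultimately have "charpoly M = (\<Prod>i\<in>UNIV. [:- d (h i), 1:])"
    by (rule charpoly_orthogonal_diagonalisation)
  also have "\<dots> = (\<Prod>i=1..?n. [:- d i, 1:])"
    by (rule prod.reindex_bij_betw[OF h])
  finally have cp: "charpoly M = (\<Prod>i=1..?n. [:- d i, 1:])" .
  have "proots (charpoly M) = (\<Sum>i=1..?n. {#d i#})"
    unfolding cp by (subst proots_prod) auto
  also have "\<dots> = mset (map (\<lambda>i. d (Suc i)) [0..<?n])"
  proof -
    have "(\<Sum>i=1..m. {#d i#}) = mset (map (\<lambda>i. d (Suc i)) [0..<m])" for m
      by (induction m) auto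
    then show ?thesis .
  qed
  also have "\<dots> = mset (rev (map (\<lambda>i. d (Suc i)) [0..<?n]))" by simp
  finally have pr: "proots (charpoly M) = mset (rev (map (\<lambda>i. d (Suc i)) [0..<?n]))" .
  \<comment> \<open>The \<open>d i\<close> already decrease, so the reversed sorted list in
    \<open>eigvals\<close> is this very list; this fixes the numbering even for repeated
    values.\<close>
  have "sorted_wrt (\<ge>) (map (\<lambda>i. d (Suc i)) [0..<?n])"
    unfolding sorted_wrt_iff_nth_less by (auto simp: d_def intro!: power_mono w(4))
  then have "sorted (rev (map (\<lambda>i. d (Suc i)) [0..<?n]))" by (simp add: sorted_wrt_rev)
  then have "eigvals M = map (\<lambda>i. d (Suc i)) [0..<?n]"
    by (simp only: eigvals_def pr sorted_list_of_multiset_mset sorted_sort_id rev_rev_ident)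
  then have sv: "norm (A *v w i) = singular_value A i" if "i \<in> {1..?n}" for i
    using that by (auto simp: singular_value_def M_def[symmetric] d_def)
  show ?thesis
  proof (rule that[OF w(1-3) sv])
    fix i j assume "1 \<le> i" "i \<le> j" "j \<le> ?n"
    then show "singular_value A j \<le> singular_value A i"
      using sv[of i] sv[of j] w(4)[of i j] by auto
  qed auto
qed

section \<open>Gram determinants and products of singular values\<close>

text \<open>\<open>norm\<close> on matrices is the Frobenius norm, so Cauchy-Schwarz can be applied
  row by row.\<close>

lemma norm_matrix_vector_le:
  fixes A :: "real^'n^'m" shows "norm (A *v x) \<le> norm A * norm x"
proof -
  have "norm (A *v x) = L2_set (\<lambda>i. \<bar>A $ i \<bullet> x\<bar>) UNIV"
    by (simp add: norm_vec_def matrix_vector_mult_def inner_vec_def)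
  also have "\<dots> \<le> L2_set (\<lambda>i. norm (A $ i) * norm x) UNIV"
    by (intro L2_set_mono) (auto intro: Cauchy_Schwarz_ineq2)
  also have "\<dots> = norm A * norm x"
    by (simp add: norm_vec_def[of A] L2_set_left_distrib)
  finally show ?thesis .
qed

lemma invertible_matrix_inv:
  fixes A :: "real^'n^'n" assumes "invertible A"
  shows "A ** matrix_inv A = mat 1" "matrix_inv A ** A = mat 1"
  using someI_ex[OF assms[unfolded invertible_def]] by (auto simp: matrix_inv_def)

lemma invertible_matrix_vector_eq_0:
  fixes A :: "real^'n^'n" assumes "invertible A" "A *v x = 0" shows "x = 0"
proof -
  have "x = matrix_inv A *v (A *v x)"
    using invertible_matrix_inv[OF assms(1)] by (simp add: matrix_vector_mul_assoc)
  then show ?thesis using assms(2) by simp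
qed

text \<open>Padding with the identity realises determinants of all sizes up to \<open>CARD('n)\<close> inside one
  matrix type.\<close>

definition corner :: "'n set \<Rightarrow> ('n \<Rightarrow> 'n \<Rightarrow> real) \<Rightarrow> real^'n^'n" where
  "corner I T = (\<chi> i j. if i \<in> I \<and> j \<in> I then T i j else if i = j then 1 else 0)"

lemma corner_mult: "corner I S ** corner I T = corner I (\<lambda>i j. \<Sum>l\<in>I. S i l * T l j)"
proof -
  have "(\<Sum>l\<in>UNIV. corner I S $ i $ l * corner I T $ l $ j) =
      corner I (\<lambda>i j. \<Sum>l\<in>I. S i l * T l j) $ i $ j" for i j
  proof (cases "i \<in> I")
    case True
    have "(\<Sum>l\<in>UNIV. corner I S $ i $ l * corner I T $ l $ j) =
        (\<Sum>l\<in>I. corner I S $ i $ l * corner I T $ l $ j)"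
      using True by (intro sum.mono_neutral_right) (auto simp: corner_def)
    also have "\<dots> = corner I (\<lambda>i j. \<Sum>l\<in>I. S i l * T l j) $ i $ j"
      using True by (auto simp: corner_def intro!: sum.neutral)
    finally show ?thesis .
  next
    case False
    have "(\<Sum>l\<in>UNIV. corner I S $ i $ l * corner I T $ l $ j) =
        (\<Sum>l\<in>{i}. corner I S $ i $ l * corner I T $ l $ j)"
      using False by (intro sum.mono_neutral_right) (auto simp: corner_def)
    then show ?thesis using False by (auto simp: corner_def)
  qed
  then show ?thesis by (simp add: vec_eq_iff matrix_matrix_mult_def)
qed

text \<open>The squared volume of the parallelepiped spanned by the vectors \<open>v i\<close> with
  \<open>i\<close> in \<open>I\<close>.\<close>

definition gram :: "'n::finite set \<Rightarrow> ('n \<Rightarrow> 'a::real_inner) \<Rightarrow> real" where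
  "gram I v = det (corner I (\<lambda>i j. v i \<bullet> v j))"

text \<open>If T is the matrix of coefficients and G the old Gram matrix, then the new Gram matrix
  is the product of the transpose of T, G and T.\<close>

lemma gram_frame_change:
  assumes "\<And>i. i \<in> I \<Longrightarrow> v' i = (\<Sum>l\<in>I. T l i *\<^sub>R v l)"
  shows "gram I v' = (det (corner I T))\<^sup>2 * gram I v"
proof -
  have "transpose (corner I T) = corner I (\<lambda>i j. T j i)"
    by (auto simp: vec_eq_iff transpose_def corner_def)
  then have "transpose (corner I T) ** corner I (\<lambda>i j. v i \<bullet> v j) ** corner I T =
      corner I (\<lambda>i j. \<Sum>l\<in>I. (\<Sum>m\<in>I. T m i * (v m \<bullet> v l)) * T l j)"
    by (simp add: corner_mult)
  also have "\<dots> = corner I (\<lambda>i j. v' i \<bullet> v' j)"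
    by (auto simp: vec_eq_iff corner_def assms inner_sum_left inner_sum_right sum_distrib_left
        sum_distrib_right ac_simps intro!: sum.cong)
  finally have eq: "transpose (corner I T) ** corner I (\<lambda>i j. v i \<bullet> v j) ** corner I T =
      corner I (\<lambda>i j. v' i \<bullet> v' j)" .
  show ?thesis
    using arg_cong[OF eq, of det] unfolding gram_def det_mul det_transpose
    by (simp add: power2_eq_square ac_simps)
qed

lemma gram_orthogonal:
  assumes "\<And>i j. i \<in> I \<Longrightarrow> j \<in> I \<Longrightarrow> i \<noteq> j \<Longrightarrow> v i \<bullet> v j = 0"
  shows "gram I v = (\<Prod>i\<in>I. (norm (v i))\<^sup>2)"
proof -
  let ?C = "corner I (\<lambda>i j. v i \<bullet> v j)"
  have "gram I v = (\<Prod>i\<in>UNIV. ?C $ i $ i)"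
    unfolding gram_def using assms by (intro det_diagonal) (auto simp: corner_def)
  also have "\<dots> = (\<Prod>i\<in>I. ?C $ i $ i)"
    by (intro prod.mono_neutral_right) (auto simp: corner_def)
  also have "\<dots> = (\<Prod>i\<in>I. (norm (v i))\<^sup>2)"
    by (intro prod.cong) (auto simp: corner_def power2_norm_eq_inner)
  finally show ?thesis .
qed

lemma gram_orthonormal: "orthonormal_on I e \<Longrightarrow> gram I e = 1"
  by (subst gram_orthogonal) (auto simp: orthonormal_on_def norm_eq_1 intro!: prod.neutral simp: power2_norm_eq_inner)

lemma norm_image_orthogonal:
  fixes f :: "'a::euclidean_space \<Rightarrow> 'b::real_inner"
  assumes f: "linear f" and u: "orthonormal_on J u" "finite J"
    and orth: "\<And>i j. i \<in> J \<Longrightarrow> j \<in> J \<Longrightarrow> i \<noteq> j \<Longrightarrow> f (u i) \<bullet> f (u j) = 0"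
    and x: "x \<in> span (u ` J)"
  shows "(norm (f x))\<^sup>2 = (\<Sum>i\<in>J. (u i \<bullet> x)\<^sup>2 * (norm (f (u i)))\<^sup>2)"
    and "(norm x)\<^sup>2 = (\<Sum>i\<in>J. (u i \<bullet> x)\<^sup>2)"
proof -
  have x': "x = (\<Sum>i\<in>J. (u i \<bullet> x) *\<^sub>R u i)" by (rule orthonormal_on_expand[OF u x])
  show "(norm x)\<^sup>2 = (\<Sum>i\<in>J. (u i \<bullet> x)\<^sup>2)"
    using inner_orthonormal_sums[OF u, of "\<lambda>i. u i \<bullet> x" "\<lambda>i. u i \<bullet> x"]
    unfolding power2_norm_eq_inner x'[symmetric] by (simp add: power2_eq_square)
  have fx: "f x = (\<Sum>i\<in>J. (u i \<bullet> x) *\<^sub>R f (u i))"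
    by (subst x') (simp add: linear_sum[OF f] linear_scale[OF f])
  have "f x \<bullet> f x = (\<Sum>i\<in>J. \<Sum>l\<in>J. if i = l then (u i \<bullet> x)\<^sup>2 * (f (u i) \<bullet> f (u i)) else 0)"
    unfolding fx inner_sum_left inner_sum_right using orth
    by (intro sum.cong) (auto simp: power2_eq_square)
  then show "(norm (f x))\<^sup>2 = (\<Sum>i\<in>J. (u i \<bullet> x)\<^sup>2 * (norm (f (u i)))\<^sup>2)"
    using u(2) by (simp add: power2_norm_eq_inner)
qed

section \<open>Extremal properties of singular values and Horn's inequality\<close>

lemma singular_value_nonneg:
  fixes A :: "real^'n^'n"
  assumes "i \<in> {1..CARD('n)}" shows "0 \<le> singular_value A i"
  by (rule singular_value_decomposition[of A]) (use assms norm_ge_zero in metis)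

text \<open>The dimension count of Courant and Fischer: the span of \<open>g 1, ..., g i\<close> has
  dimension i and that of \<open>w i, ..., w n\<close> has dimension n + 1 - i, so they share some x
  other than 0. On the first space the expansion is at least that of \<open>g i\<close>, on the
  second at most the i-th singular value.\<close>

lemma singular_value_interlacing:
  fixes A :: "real^'n^'n"
  assumes g: "orthonormal_on {1..k} g"
    and orth: "\<And>i j. i \<in> {1..k} \<Longrightarrow> j \<in> {1..k} \<Longrightarrow> i \<noteq> j \<Longrightarrow> (A *v g i) \<bullet> (A *v g j) = 0"
    and mono: "\<And>i j. 1 \<le> i \<Longrightarrow> i \<le> j \<Longrightarrow> j \<le> k \<Longrightarrow> norm (A *v g j) \<le> norm (A *v g i)"
    and i: "i \<in> {1..k}" and k: "k \<le> CARD('n)"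
  shows "norm (A *v g i) \<le> singular_value A i"
proof -
  let ?n = "CARD('n)"
  obtain w :: "nat \<Rightarrow> real^'n" where w: "orthonormal_on {1..?n} w"
    "\<And>i j. i \<in> {1..?n} \<Longrightarrow> j \<in> {1..?n} \<Longrightarrow> i \<noteq> j \<Longrightarrow> (A *v w i) \<bullet> (A *v w j) = 0"
    "\<And>i. i \<in> {1..?n} \<Longrightarrow> norm (A *v w i) = singular_value A i"
    "\<And>i j. 1 \<le> i \<Longrightarrow> i \<le> j \<Longrightarrow> j \<le> ?n \<Longrightarrow> singular_value A j \<le> singular_value A i"
    by (rule singular_value_decomposition[of A]) metis
  let ?X = "span (g ` {1..i})" and ?Y = "span (w ` {i..?n})"
  have oX: "orthonormal_on {1..i} g" and oY: "orthonormal_on {i..?n} w"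
    using g w(1) i k by (auto elim!: orthonormal_on_subset)
  have dims: "dim ?X = i" "dim ?Y = ?n + 1 - i"
    using orthonormal_on_dim_span[OF oX] orthonormal_on_dim_span[OF oY] by auto
  have "dim {x + y |x y. x \<in> ?X \<and> y \<in> ?Y} + dim (?X \<inter> ?Y) = dim ?X + dim ?Y"
    by (rule dim_sums_Int) auto
  moreover have "dim {x + y |x y. x \<in> ?X \<and> y \<in> ?Y} \<le> ?n"
    using dim_subset_UNIV[of "{x + y |x y. x \<in> ?X \<and> y \<in> ?Y}"] by simp
  ultimately have "dim (?X \<inter> ?Y) \<noteq> 0" using dims i k by linarith
  then obtain x where x: "x \<in> ?X" "x \<in> ?Y" "x \<noteq> 0"
    by (metis IntD1 IntD2 dim_eq_0 singletonI subsetI)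
  have *: "(norm (A *v x))\<^sup>2 = (\<Sum>l=1..i. (g l \<bullet> x)\<^sup>2 * (norm (A *v g l))\<^sup>2)"
    "(norm x)\<^sup>2 = (\<Sum>l=1..i. (g l \<bullet> x)\<^sup>2)"
    by (rule norm_image_orthogonal[OF matrix_vector_mul_linear[of A] oX _ _ x(1)]; use orth i in simp)+
  have **: "(norm (A *v x))\<^sup>2 = (\<Sum>l=i..?n. (w l \<bullet> x)\<^sup>2 * (norm (A *v w l))\<^sup>2)"
    "(norm x)\<^sup>2 = (\<Sum>l=i..?n. (w l \<bullet> x)\<^sup>2)"
    by (rule norm_image_orthogonal[OF matrix_vector_mul_linear[of A] oY _ _ x(2)]; use w(2) i in simp)+
  have "(norm (A *v g i))\<^sup>2 * (norm x)\<^sup>2 \<le> (norm (A *v x))\<^sup>2"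
    unfolding * sum_distrib_left using i
    by (intro sum_mono) (auto simp: mult.commute intro!: mult_right_mono mult_left_mono power_mono mono)
  also have "\<dots> \<le> (singular_value A i)\<^sup>2 * (norm x)\<^sup>2"
    unfolding ** sum_distrib_left using i w(3)
    by (intro sum_mono) (auto simp: mult.commute intro!: mult_right_mono mult_left_mono power_mono w(4) singular_value_nonneg)
  finally have "(norm (A *v g i))\<^sup>2 \<le> (singular_value A i)\<^sup>2" using x(3) by simp
  moreover have "singular_value A i \<ge> 0" using w(3)[of i, symmetric] i k by auto
  ultimately show ?thesis by (rule power2_le_imp_le)
qed

lemma singular_value_antimono:
  fixes A :: "real^'n^'n"
  assumes "1 \<le> i" "i \<le> j" "j \<le> CARD('n)" shows "singular_value A j \<le> singular_value A i"
  by (rule singular_value_decomposition[of A]) (use assms in metis)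

lemma singular_value_bounds:
  fixes A :: "real^'n^'n"
  assumes i: "i \<in> {1..CARD('n)}"
  shows "(\<And>x. c * norm x \<le> norm (A *v x)) \<Longrightarrow> c \<le> singular_value A i"
    and "(\<And>x. norm (A *v x) \<le> c * norm x) \<Longrightarrow> singular_value A i \<le> c"
proof -
  obtain w :: "nat \<Rightarrow> real^'n" where w: "orthonormal_on {1..CARD('n)} w"
    "\<And>i. i \<in> {1..CARD('n)} \<Longrightarrow> norm (A *v w i) = singular_value A i"
    by (rule singular_value_decomposition[of A]) metis
  note * = orthonormal_on_norm[OF w(1) i] w(2)[OF i]
  show "c \<le> singular_value A i" if "\<And>x. c * norm x \<le> norm (A *v x)"
    using that[of "w i"] * by simp
  show "singular_value A i \<le> c" if "\<And>x. norm (A *v x) \<le> c * norm x"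
    using that[of "w i"] * by simp
qed

lemma singular_value_pos:
  fixes A :: "real^'n^'n"
  assumes "invertible A" "i \<in> {1..CARD('n)}" shows "0 < singular_value A i"
proof -
  obtain w :: "nat \<Rightarrow> real^'n" where w: "orthonormal_on {1..CARD('n)} w"
    "\<And>i. i \<in> {1..CARD('n)} \<Longrightarrow> norm (A *v w i) = singular_value A i"
    by (rule singular_value_decomposition[of A]) metis
  have "w i \<noteq> 0" using orthonormal_on_norm[OF w(1) assms(2)] by auto
  then show ?thesis
    using invertible_matrix_vector_eq_0[OF assms(1)] w(2)[OF assms(2)] by (metis norm_eq_zero zero_less_norm_iff)
qed

text \<open>By invariance of the Gram determinant under orthogonal changes of frame, one may replace
  \<open>e\<close> by a frame of its span with orthogonal images, to which interlacing applies factor by factor.\<close>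

lemma gram_image_le:
  fixes A :: "real^'n^'n" and e :: "'n \<Rightarrow> real^'n"
  assumes e: "orthonormal_on I e"
  shows "gram I (\<lambda>i. A *v e i) \<le> (\<Prod>i=1..card I. singular_value A i)\<^sup>2"
proof -
  let ?k = "card I"
  have k: "?k \<le> CARD('n)" by (intro card_mono) auto
  have dim: "dim (span (e ` I)) = ?k" using orthonormal_on_dim_span[OF e] by simp
  from ordered_singular_basis[OF matrix_vector_mul_linear[of A] subspace_span[of "e ` I"], unfolded dim]
  obtain g where g: "orthonormal_on {1..?k} g" "span (g ` {1..?k}) = span (e ` I)"
    "\<And>i j. i \<in> {1..?k} \<Longrightarrow> j \<in> {1..?k} \<Longrightarrow> i \<noteq> j \<Longrightarrow> (A *v g i) \<bullet> (A *v g j) = 0"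
    "\<And>i j. 1 \<le> i \<Longrightarrow> i \<le> j \<Longrightarrow> j \<le> ?k \<Longrightarrow> norm (A *v g j) \<le> norm (A *v g i)"
    by metis
  obtain h where h: "bij_betw h I {1..?k}"
    using finite_same_card_bij[of I "{1..?k}"] by auto
  have hin: "h i \<in> {1..?k}" if "i \<in> I" for i using h that by (auto simp: bij_betw_def)
  have hne: "h i = h j \<longleftrightarrow> i = j" if "i \<in> I" "j \<in> I" for i j
    using h that by (auto simp: bij_betw_def inj_on_def)
  define f where "f i = g (h i)" for i
  have f: "orthonormal_on I f"
    using g(1) hin hne by (auto simp: f_def orthonormal_on_def)
  have "f ` I = g ` {1..?k}" using h by (simp add: f_def bij_betw_def flip: image_image)
  then have "e i \<in> span (f ` I)" if "i \<in> I" for i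
    using g(2) that by (simp add: span_base)
  then have ef: "e i = (\<Sum>l\<in>I. (f l \<bullet> e i) *\<^sub>R f l)" if "i \<in> I" for i
    using that by (intro orthonormal_on_expand[OF f]) auto
  have Aef: "A *v e i = (\<Sum>l\<in>I. (f l \<bullet> e i) *\<^sub>R (A *v f l))" if "i \<in> I" for i
    by (subst ef[OF that]) (simp add: linear_sum[OF matrix_vector_mul_linear] matrix_vector_mult_scaleR)
  \<comment> \<open>Both frames are orthonormal and have Gram determinant 1, so the frame change
    formula forces this square to be 1.\<close>
  have "(det (corner I (\<lambda>l i. f l \<bullet> e i)))\<^sup>2 = 1"
    using gram_frame_change[of I e, OF ef] gram_orthonormal[OF e] gram_orthonormal[OF f] by simp
  then have "gram I (\<lambda>i. A *v e i) = gram I (\<lambda>i. A *v f i)"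
    using gram_frame_change[of I "\<lambda>i. A *v e i", OF Aef] by simp
  also have "\<dots> = (\<Prod>i\<in>I. (norm (A *v f i))\<^sup>2)"
    using g(3) hin hne by (intro gram_orthogonal) (auto simp: f_def)
  also have "\<dots> = (\<Prod>i=1..?k. (norm (A *v g i))\<^sup>2)"
    unfolding f_def by (rule prod.reindex_bij_betw[OF h])
  also have "\<dots> \<le> (\<Prod>i=1..?k. (singular_value A i)\<^sup>2)"
    using singular_value_interlacing[OF g(1,3,4) _ k]
    by (intro prod_mono conjI power_mono) auto
  finally show ?thesis by (simp add: prod_power_distrib)
qed

text \<open>Take for \<open>e\<close> the first k right singular vectors of \<open>A ** B\<close>,
  for which the volume expansion is exactly the left-hand product, and an orthonormal frame
  \<open>f\<close> of the image of their span under \<open>B\<close>. Changing frames splits the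
  Gram determinant into that of \<open>B *v e i\<close> times that of \<open>A *v f i\<close>, and
  \<open>gram_image_le\<close> bounds each. Invertibility of \<open>B\<close> keeps the image
  k-dimensional.\<close>

lemma prod_singular_value_mult_le:
  fixes A B :: "real^'n^'n"
  assumes k: "k \<le> CARD('n)" and B: "invertible B"
  shows "(\<Prod>i=1..k. singular_value (A ** B) i) \<le>
    (\<Prod>i=1..k. singular_value A i) * (\<Prod>i=1..k. singular_value B i)"
proof -
  let ?n = "CARD('n)"
  \<comment> \<open>\<open>gram\<close> takes its indices from the type \<open>'n\<close>, so k
    vectors are indexed by a k-element subset.\<close>
  obtain I :: "'n set" where I: "card I = k" using k by (metis obtain_subset_with_card_n)
  obtain w :: "nat \<Rightarrow> real^'n" where w: "orthonormal_on {1..?n} w"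
    "\<And>i j. i \<in> {1..?n} \<Longrightarrow> j \<in> {1..?n} \<Longrightarrow> i \<noteq> j \<Longrightarrow> ((A ** B) *v w i) \<bullet> ((A ** B) *v w j) = 0"
    "\<And>i. i \<in> {1..?n} \<Longrightarrow> norm ((A ** B) *v w i) = singular_value (A ** B) i"
    by (rule singular_value_decomposition[of "A ** B"]) metis
  obtain h where h: "bij_betw h I {1..k}"
    using finite_same_card_bij[of I "{1..k}"] I by auto
  have hin: "h i \<in> {1..?n}" if "i \<in> I" for i using bij_betwE[OF h] that k by force
  have hne: "h i = h j \<longleftrightarrow> i = j" if "i \<in> I" "j \<in> I" for i j
    using h that by (auto simp: bij_betw_def inj_on_def)
  define e where "e i = w (h i)" for i
  have e: "orthonormal_on I e"
    using w(1) hin hne by (auto simp: e_def orthonormal_on_def)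
  let ?V = "span ((\<lambda>i. B *v e i) ` I)"
  have "inj ((*v) B)"
    using invertible_matrix_vector_eq_0[OF B] by (simp add: linear_injective_0)
  then have "dim ((*v) B ` span (e ` I)) = k"
    using dim_image_eq[of "(*v) B"] orthonormal_on_dim_span[OF e] I
    by (simp add: inj_on_subset)
  then have dim: "dim ?V = k"
    by (simp add: image_image flip: linear_span_image[OF matrix_vector_mul_linear])
  obtain F where F: "pairwise orthogonal F" "\<And>x. x \<in> F \<Longrightarrow> norm x = 1"
      "independent F" "card F = k" "span F = ?V"
    using orthonormal_basis_subspace[OF subspace_span[of "(\<lambda>i. B *v e i) ` I"]] dim by metis
  have "finite F" using F(3) independent_imp_finite by blast
  then obtain f where f': "bij_betw f I F"
    using finite_same_card_bij[of I F] F(4) I by auto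
  have f: "orthonormal_on I f"
    unfolding orthonormal_on_def
  proof (intro ballI)
    fix i j assume ij: "i \<in> I" "j \<in> I"
    then have "f i \<in> F" "f j \<in> F" "f i = f j \<longleftrightarrow> i = j"
      using f' by (auto simp: bij_betw_def inj_on_def)
    then show "f i \<bullet> f j = (if i = j then 1 else 0)"
      using F(1,2) by (auto simp: pairwise_def orthogonal_def norm_eq_1)
  qed
  have "f ` I = F" using f' by (simp add: bij_betw_def)
  then have "B *v e i \<in> span (f ` I)" if "i \<in> I" for i
    using F(5) that by (simp add: span_base)
  then have Bef: "B *v e i = (\<Sum>l\<in>I. (f l \<bullet> (B *v e i)) *\<^sub>R f l)" if "i \<in> I" for i
    using that by (intro orthonormal_on_expand[OF f]) auto
  have ABef: "(A ** B) *v e i = (\<Sum>l\<in>I. (f l \<bullet> (B *v e i)) *\<^sub>R (A *v f l))" if "i \<in> I" for i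
  proof -
    have "(A ** B) *v e i = A *v (\<Sum>l\<in>I. (f l \<bullet> (B *v e i)) *\<^sub>R f l)"
      using Bef[OF that] by (simp flip: matrix_vector_mul_assoc)
    then show ?thesis
      by (simp add: linear_sum[OF matrix_vector_mul_linear] matrix_vector_mult_scaleR)
  qed
  have "gram I (\<lambda>i. (A ** B) *v e i) = gram I (\<lambda>i. B *v e i) * gram I (\<lambda>i. A *v f i)"
    using gram_frame_change[of I "\<lambda>i. (A ** B) *v e i", OF ABef]
      gram_frame_change[of I "\<lambda>i. B *v e i", OF Bef] gram_orthonormal[OF f] by simp
  also have "\<dots> \<le> gram I (\<lambda>i. B *v e i) * (\<Prod>i=1..k. singular_value A i)\<^sup>2"
    using gram_image_le[OF f, of A] I gram_frame_change[of I "\<lambda>i. B *v e i", OF Bef] gram_orthonormal[OF f]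
    by (intro mult_left_mono) auto
  also have "\<dots> \<le> (\<Prod>i=1..k. singular_value B i)\<^sup>2 * (\<Prod>i=1..k. singular_value A i)\<^sup>2"
    using gram_image_le[OF e, of B] I by (intro mult_right_mono) auto
  finally have "gram I (\<lambda>i. (A ** B) *v e i) \<le>
      ((\<Prod>i=1..k. singular_value A i) * (\<Prod>i=1..k. singular_value B i))\<^sup>2"
    by (simp add: power_mult_distrib mult.commute)
  moreover have "gram I (\<lambda>i. (A ** B) *v e i) = (\<Prod>i\<in>I. (norm ((A ** B) *v e i))\<^sup>2)"
    using w(2) hin hne by (intro gram_orthogonal) (auto simp: e_def)
  moreover have "(\<Prod>i\<in>I. (norm ((A ** B) *v e i))\<^sup>2) = (\<Prod>i=1..k. (norm ((A ** B) *v w i))\<^sup>2)"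
    unfolding e_def by (rule prod.reindex_bij_betw[OF h])
  moreover have "\<dots> = (\<Prod>i=1..k. singular_value (A ** B) i)\<^sup>2"
    unfolding prod_power_distrib using k w(3) by (intro prod.cong) auto
  ultimately have "(\<Prod>i=1..k. singular_value (A ** B) i)\<^sup>2 \<le>
      ((\<Prod>i=1..k. singular_value A i) * (\<Prod>i=1..k. singular_value B i))\<^sup>2" by simp
  then show ?thesis
    using k by (rule_tac power2_le_imp_le) (auto intro!: mult_nonneg_nonneg prod_nonneg singular_value_nonneg)
qed

section \<open>The logarithm of the singular value function\<close>

text \<open>The exponent of the i-th singular value in omega_d: 1 up to floor(d), the fractional
  part of d at the next index, 0 beyond.\<close>

definition clamp :: "real \<Rightarrow> nat \<Rightarrow> real" where
  "clamp d i = max 0 (min 1 (d - (real i - 1)))"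

text \<open>The logarithm of \<open>sv_function d A\<close> for invertible \<open>A\<close>. Summing
  over all indices with weights replaces the case distinction on integer d and allows comparisons in
  d term by term.\<close>

definition lsv :: "real \<Rightarrow> real^'n^'n \<Rightarrow> real" where
  "lsv d A = (\<Sum>i=1..CARD('n). clamp d i * ln (singular_value A i))"

lemma clamp_nonneg: "0 \<le> clamp d i" by (simp add: clamp_def)

lemma clamp_mono: "d \<le> d' \<Longrightarrow> clamp d i \<le> clamp d' i" by (auto simp: clamp_def)

lemma real_nat_frac_cases:
  fixes d :: real assumes "0 \<le> d" "d \<le> real n"
  obtains k \<theta> where "d = real k + \<theta>" "0 \<le> \<theta>" "\<theta> < 1" "k = nat \<lfloor>d\<rfloor>" "k < n \<or> k = n \<and> \<theta> = 0"
proof (rule that[of "nat \<lfloor>d\<rfloor>" "frac d"])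
  show 1: "d = real (nat \<lfloor>d\<rfloor>) + frac d" using assms by (simp add: frac_def)
  have "real (nat \<lfloor>d\<rfloor>) \<le> real n" using assms by linarith
  then show "nat \<lfloor>d\<rfloor> < n \<or> nat \<lfloor>d\<rfloor> = n \<and> frac d = 0"
    using 1 assms frac_ge_0[of d] by (cases "nat \<lfloor>d\<rfloor> = n") linarith+
qed (auto simp: frac_lt_1)

text \<open>The value 1 is allowed for the fractional weight because s = 1 occurs in the theorem.
  The last assumption keeps index n + 1 from contributing.\<close>

lemma sum_clamp:
  assumes "0 \<le> \<theta>" "\<theta> \<le> 1" "k < n \<or> k = n \<and> \<theta> = 0"
  shows "(\<Sum>i=1..n. clamp (real k + \<theta>) i * x i) = (\<Sum>i=1..k. x i) + \<theta> * x (k + 1)"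
proof -
  have 1: "clamp (real k + \<theta>) i = 1" if "i \<le> k" for i using that assms by (simp add: clamp_def)
  have 2: "clamp (real k + \<theta>) (k + 1) = \<theta>" using assms by (simp add: clamp_def)
  have 3: "clamp (real k + \<theta>) i = 0" if "i > k + 1" for i using that assms by (simp add: clamp_def)
  show ?thesis
  proof (cases "k < n")
    case True
    have "(\<Sum>i=1..n. clamp (real k + \<theta>) i * x i) = (\<Sum>i=1..k+1. clamp (real k + \<theta>) i * x i)"
      using True 3 by (intro sum.mono_neutral_right) auto
    also have "\<dots> = (\<Sum>i=1..k. clamp (real k + \<theta>) i * x i) + clamp (real k + \<theta>) (k + 1) * x (k + 1)"
      by simp
    also have "(\<Sum>i=1..k. clamp (real k + \<theta>) i * x i) = (\<Sum>i=1..k. x i)"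
      using 1 by (intro sum.cong) auto
    finally show ?thesis by (simp only: 2)
  next
    case False
    then show ?thesis using assms 1 by auto
  qed
qed

lemma sum_clamp_1:
  assumes "0 \<le> d" "d \<le> real n" shows "(\<Sum>i=1..n. clamp d i) = d"
proof -
  obtain k \<theta> where k: "d = real k + \<theta>" "0 \<le> \<theta>" "\<theta> < 1" "k < n \<or> k = n \<and> \<theta> = 0"
    using real_nat_frac_cases[OF assms] by metis
  then show ?thesis using sum_clamp[of \<theta> k n "\<lambda>_. 1"] by simp
qed

lemma lsv_eq:
  fixes A :: "real^'n^'n"
  assumes "0 \<le> \<theta>" "\<theta> \<le> 1" "k < CARD('n) \<or> k = CARD('n) \<and> \<theta> = 0"
  shows "lsv (real k + \<theta>) A = (\<Sum>i=1..k. ln (singular_value A i)) + \<theta> * ln (singular_value A (k + 1))"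
  unfolding lsv_def by (rule sum_clamp[OF assms])

lemma sv_function_eq_exp_lsv:
  fixes A :: "real^'n^'n"
  assumes A: "invertible A" and d: "0 \<le> d" "d \<le> real CARD('n)"
  shows "sv_function d A = exp (lsv d A)"
proof -
  obtain k \<theta> where k: "d = real k + \<theta>" "0 \<le> \<theta>" "\<theta> < 1" "k = nat \<lfloor>d\<rfloor>" "k < CARD('n) \<or> k = CARD('n) \<and> \<theta> = 0"
    using real_nat_frac_cases[OF d] by metis
  have P: "(\<Prod>i=1..k. singular_value A i) = exp (\<Sum>i=1..k. ln (singular_value A i))"
    unfolding exp_sum[OF finite_atLeastAtMost]
    using singular_value_pos[OF A] k(5) by (intro prod.cong) (auto simp: less_imp_le)
  have fl: "\<lfloor>d\<rfloor> = int k" using k d by auto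
  have Z: "d \<in> \<int> \<longleftrightarrow> \<theta> = 0"
    using fl k(1) by (auto elim!: Ints_cases)
  show ?thesis
  proof (cases "\<theta> = 0")
    case True
    then show ?thesis using Z P lsv_eq[of \<theta> k A] k(1,2,3,5) fl by (simp add: sv_function_def)
  next
    case False
    then have "0 < singular_value A (k + 1)" using singular_value_pos[OF A] k(5) by auto
    then have "singular_value A (k + 1) powr \<theta> = exp (\<theta> * ln (singular_value A (k + 1)))"
      by (simp add: powr_def)
    then show ?thesis using False Z P lsv_eq[of \<theta> k A] k(1,2,3,5) fl
      by (simp add: sv_function_def exp_add)
  qed
qed

lemma sum_ln_singular_value_mult_le:
  fixes A B :: "real^'n^'n"
  assumes k: "k \<le> CARD('n)" and AB: "invertible A" "invertible B"
  shows "(\<Sum>i=1..k. ln (singular_value (A ** B) i)) \<le>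
    (\<Sum>i=1..k. ln (singular_value A i)) + (\<Sum>i=1..k. ln (singular_value B i))"
proof -
  have pos: "0 < singular_value X i" if "invertible X" "i \<in> {1..k}" for i and X :: "real^'n^'n"
    using singular_value_pos[OF that(1)] that(2) k by auto
  have AB': "invertible (A ** B)" using AB by (rule invertible_mult)
  have *: "ln (\<Prod>i=1..k. singular_value X i) = (\<Sum>i=1..k. ln (singular_value X i))"
    "0 < (\<Prod>i=1..k. singular_value X i)"
    if "invertible X" for X :: "real^'n^'n"
    using pos[OF that] by (auto intro!: ln_prod prod_pos simp: less_imp_neq[symmetric])
  have "ln (\<Prod>i=1..k. singular_value (A ** B) i) \<le>
     ln ((\<Prod>i=1..k. singular_value A i) * (\<Prod>i=1..k. singular_value B i))"
    using prod_singular_value_mult_le[OF k AB(2)] *(2)[OF AB'] *(2)[OF AB(1)] *(2)[OF AB(2)]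
    by (subst ln_le_cancel_iff) auto
  then show ?thesis using *[OF AB'] *[OF AB(1)] *[OF AB(2)] by (simp only: ln_mult_pos)
qed

text \<open>\<open>lsv d\<close> is the convex combination, with weights 1 - theta and theta, of its
  values at the integers k and k + 1, where subadditivity is Horn's inequality.\<close>

lemma lsv_mult_le:
  fixes A B :: "real^'n^'n"
  assumes AB: "invertible A" "invertible B" and d: "0 \<le> d" "d \<le> real CARD('n)"
  shows "lsv d (A ** B) \<le> lsv d A + lsv d B"
proof -
  obtain k \<theta> where k: "d = real k + \<theta>" "0 \<le> \<theta>" "\<theta> < 1" "k < CARD('n) \<or> k = CARD('n) \<and> \<theta> = 0"
    using real_nat_frac_cases[OF d] by metis
  define s where "s m X = (\<Sum>i=1..m. ln (singular_value X i))" for m and X :: "real^'n^'n"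
  have L: "lsv d X = (1 - \<theta>) * s k X + \<theta> * s (k + 1) X" for X :: "real^'n^'n"
    using lsv_eq[of \<theta> k X] k by (simp add: s_def algebra_simps)
  have "s k (A ** B) \<le> s k A + s k B"
    unfolding s_def using k by (intro sum_ln_singular_value_mult_le AB) auto
  moreover have "\<theta> * s (k + 1) (A ** B) \<le> \<theta> * (s (k + 1) A + s (k + 1) B)"
    using k(4)
  proof
    assume "k < CARD('n)"
    then show ?thesis unfolding s_def using k(2)
      by (intro mult_left_mono sum_ln_singular_value_mult_le AB) auto
  qed simp
  moreover have "(1 - \<theta>) * s k (A ** B) \<le> (1 - \<theta>) * (s k A + s k B)"
    using k calculation(1) by (intro mult_left_mono) auto
  ultimately show ?thesis unfolding L by (simp add: algebra_simps)
qed

section \<open>Dependence of \<open>lsv\<close> on the exponent and on the matrix\<close>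

lemma lsv_le:
  fixes A :: "real^'n^'n"
  assumes A: "invertible A" and d: "0 \<le> d" "d \<le> real CARD('n)"
    and M: "\<And>x. norm (A *v x) \<le> M * norm x"
  shows "lsv d A \<le> d * ln M"
proof -
  have "lsv d A \<le> (\<Sum>i=1..CARD('n). clamp d i * ln M)"
    unfolding lsv_def
  proof (intro sum_mono mult_left_mono clamp_nonneg)
    fix i assume i: "i \<in> {1..CARD('n)}"
    show "ln (singular_value A i) \<le> ln M"
      using singular_value_pos[OF A i] singular_value_bounds(2)[OF i M] by simp
  qed
  then show ?thesis using sum_clamp_1[OF d] by (simp flip: sum_distrib_right)
qed

text \<open>Lowering d to d' removes total weight d - d' from logarithms that are all at least
  \<open>ln c\<close>. The loss does not depend on the matrix beyond c, so it is uniform along a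
  compact set.\<close>

lemma lsv_shift:
  fixes A :: "real^'n^'n"
  assumes c: "0 < c" "\<And>x. c * norm x \<le> norm (A *v x)"
    and d: "0 \<le> d'" "d' \<le> d" "d \<le> real CARD('n)"
  shows "lsv d' A \<le> lsv d A - (d - d') * ln c"
proof -
  have "0 \<le> (\<Sum>i=1..CARD('n). (clamp d i - clamp d' i) * (ln (singular_value A i) - ln c))"
  proof (intro sum_nonneg mult_nonneg_nonneg)
    fix i assume i: "i \<in> {1..CARD('n)}"
    show "0 \<le> ln (singular_value A i) - ln c"
      using singular_value_bounds(1)[OF i c(2)] c(1) by simp
  qed (use clamp_mono[OF d(2)] in auto)
  also have "\<dots> = lsv d A - lsv d' A - (\<Sum>i=1..CARD('n). clamp d i) * ln c + (\<Sum>i=1..CARD('n). clamp d' i) * ln c"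
    by (simp add: lsv_def algebra_simps sum_subtractf sum.distrib sum_distrib_left)
  finally show ?thesis using sum_clamp_1[of d "CARD('n)"] sum_clamp_1[of d' "CARD('n)"] d
    by (simp add: algebra_simps)
qed

text \<open>A negative sum has a negative term, at some index m of positive weight. Indices before m
  already have full weight, and from m on all logarithms are negative because singular values
  decrease; so raising d adds nothing positive.\<close>

lemma lsv_negative_upward:
  fixes A :: "real^'n^'n"
  assumes A: "invertible A" and neg: "lsv d A < 0" and d: "d \<le> d'"
  shows "lsv d' A < 0"
proof -
  let ?l = "\<lambda>i. ln (singular_value A i)"
  have "\<exists>i\<in>{1..CARD('n)}. clamp d i * ?l i < 0"
    using neg unfolding lsv_def by (meson not_le sum_nonneg)
  then obtain m where m: "m \<in> {1..CARD('n)}" "clamp d m * ?l m < 0" by blast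
  then have m': "?l m < 0" "clamp d m > 0"
    using clamp_nonneg[of d m] by (auto simp: mult_less_0_iff)
  have "(clamp d' i - clamp d i) * ?l i \<le> 0" if i: "i \<in> {1..CARD('n)}" for i
  proof (cases "i < m")
    case True
    then have "clamp d i = 1" using m'(2) by (auto simp: clamp_def)
    moreover have "clamp d' i = 1"
      using clamp_mono[OF d, of i] calculation by (simp add: clamp_def)
    ultimately show ?thesis by simp
  next
    case False
    then have "?l i \<le> ?l m"
      using singular_value_antimono[of m i A] singular_value_pos[OF A i] m i by simp
    then show ?thesis using m' clamp_mono[OF d, of i] by (simp add: mult_nonneg_nonpos)
  qed
  then have "(\<Sum>i=1..CARD('n). (clamp d' i - clamp d i) * ?l i) \<le> 0"
    by (intro sum_nonpos) auto
  then have "lsv d' A \<le> lsv d A"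
    by (simp add: lsv_def left_diff_distrib sum_subtractf)
  then show ?thesis using neg by simp
qed

text \<open>Writing \<open>B = (B ** matrix_inv A) ** A\<close> gives semicontinuity without continuity of the
  individual singular values.\<close>

lemma lsv_perturb:
  fixes A B :: "real^'n^'n"
  assumes AB: "invertible A" "invertible B" and d: "0 \<le> d" "d \<le> real CARD('n)"
  shows "lsv d B \<le> lsv d A + d * (norm (B - A) * norm (matrix_inv A))"
proof -
  let ?c = "norm (B - A) * norm (matrix_inv A)"
  let ?X = "B ** matrix_inv A"
  have iA: "invertible (matrix_inv A)"
    using invertible_matrix_inv[OF AB(1)] by (auto simp: invertible_def)
  then have X: "invertible ?X" using AB by (intro invertible_mult)
  have "norm (?X *v x) \<le> (1 + ?c) * norm x" for x
  proof -
    have "?X *v x = A *v (matrix_inv A *v x) + (B - A) *v (matrix_inv A *v x)"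
      by (simp add: matrix_vector_mult_diff_rdistrib flip: matrix_vector_mul_assoc)
    also have "A *v (matrix_inv A *v x) = x"
      using invertible_matrix_inv[OF AB(1)] by (simp add: matrix_vector_mul_assoc)
    finally have "norm (?X *v x) \<le> norm x + norm ((B - A) *v (matrix_inv A *v x))"
      by (metis norm_triangle_ineq)
    also have "norm ((B - A) *v (matrix_inv A *v x)) \<le> norm (B - A) * (norm (matrix_inv A) * norm x)"
      by (meson norm_matrix_vector_le order_trans mult_left_mono norm_ge_zero)
    finally show ?thesis by (simp add: algebra_simps)
  qed
  from lsv_le[OF X d this] have "lsv d ?X \<le> d * ln (1 + ?c)" .
  also have "\<dots> \<le> d * ?c" using d by (intro mult_left_mono ln_add_one_self_le_self) auto
  finally have "lsv d ?X \<le> d * ?c" .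
  moreover have "?X ** A = B"
    using invertible_matrix_inv[OF AB(1)] by (simp flip: matrix_mul_assoc)
  then have "lsv d B \<le> lsv d ?X + lsv d A"
    using lsv_mult_le[OF X AB(1) d] by simp
  ultimately show ?thesis by simp
qed

text \<open>Near each point at least half of the negative value persists, by the one-sided estimate
  \<open>lsv_perturb\<close>; a finite subcover then gives the uniform bound.\<close>

lemma lsv_uniform_negative:
  fixes J :: "'a::metric_space \<Rightarrow> real^'n^'n"
  assumes K: "compact K" and J: "continuous_on K J" "\<And>u. u \<in> K \<Longrightarrow> invertible (J u)"
    and d: "0 \<le> d" "d \<le> real CARD('n)" and neg: "\<And>u. u \<in> K \<Longrightarrow> lsv d (J u) < 0"
  obtains \<kappa> where "\<kappa> < 0" "\<And>u. u \<in> K \<Longrightarrow> lsv d (J u) \<le> \<kappa>"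
proof -
  have "\<exists>r>0. \<forall>v\<in>K. dist v u < r \<longrightarrow> lsv d (J v) \<le> lsv d (J u) / 2" if u: "u \<in> K" for u
  proof -
    define C where "C = d * norm (matrix_inv (J u)) + 1"
    have C: "C > 0" using d by (simp add: C_def add_nonneg_pos)
    then have "- (lsv d (J u) / 2) / C > 0" using neg[OF u] by (intro divide_pos_pos) auto
    then obtain r where r: "r > 0" "\<And>v. v \<in> K \<Longrightarrow> dist v u < r \<Longrightarrow> dist (J v) (J u) < - (lsv d (J u) / 2) / C"
      using J(1) u unfolding continuous_on_iff by metis
    show ?thesis
    proof (intro exI[of _ r] conjI ballI impI r(1))
      fix v assume v: "v \<in> K" "dist v u < r"
      have "lsv d (J v) \<le> lsv d (J u) + d * (norm (J v - J u) * norm (matrix_inv (J u)))"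
        using lsv_perturb[OF J(2)[OF u] J(2)[OF v(1)] d] .
      also have "d * (norm (J v - J u) * norm (matrix_inv (J u))) \<le> dist (J v) (J u) * C"
        by (simp add: C_def dist_norm algebra_simps)
      also have "\<dots> \<le> - (lsv d (J u) / 2)" using r(2)[OF v] C by (simp add: field_simps)
      finally show "lsv d (J v) \<le> lsv d (J u) / 2" by simp
    qed
  qed
  then obtain r where r: "\<And>u. u \<in> K \<Longrightarrow> r u > 0"
    "\<And>u v. u \<in> K \<Longrightarrow> v \<in> K \<Longrightarrow> dist v u < r u \<Longrightarrow> lsv d (J v) \<le> lsv d (J u) / 2"
    by metis
  obtain F where F: "F \<subseteq> K" "finite F" "K \<subseteq> (\<Union>u\<in>F. ball u (r u))"
  proof (rule compactE_image[OF K, of K "\<lambda>u. ball u (r u)"])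
    show "K \<subseteq> (\<Union>u\<in>K. ball u (r u))" using r(1) by force
  qed auto
  \<comment> \<open>The entry -1 keeps the maximum defined and negative when \<open>F\<close> is
    empty.\<close>
  define \<kappa> where "\<kappa> = Max (insert (-1) ((\<lambda>u. lsv d (J u) / 2) ` F))"
  show thesis
  proof
    show "\<kappa> < 0" unfolding \<kappa>_def using F(1,2) neg by (subst Max_less_iff) auto
    fix v assume v: "v \<in> K"
    then obtain u where u: "u \<in> F" "dist v u < r u" using F(3) by (auto simp: dist_commute)
    then have "lsv d (J v) \<le> lsv d (J u) / 2" using r(2) F(1) v by blast
    also have "\<dots> \<le> \<kappa>" unfolding \<kappa>_def using F(2) u(1) by (intro Max_ge) auto
    finally show "lsv d (J v) \<le> \<kappa>" .
  qed
qed

section \<open>Covers by balls and Hausdorff measure\<close>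

text \<open>In this form the bounds multiply well: a direction with \<open>a\<close> at most
  \<open>\<rho>\<close> costs only the constant 2, so only long axes count in a box.\<close>

lemma interval_net:
  fixes a \<rho> :: real
  assumes "0 \<le> a" "0 < \<rho>"
  obtains T :: "real set" where "finite T" "real (card T) \<le> 2 * max 1 (a / \<rho>)"
    "\<And>x. \<bar>x\<bar> \<le> a \<Longrightarrow> \<exists>t\<in>T. \<bar>x - t\<bar> \<le> \<rho>"
proof -
  \<comment> \<open>Midpoints of consecutive cells of length \<open>2 * \<rho>\<close> starting at
    \<open>-a\<close>; the last index is that of the cell containing x = a.\<close>
  define T where "T = (\<lambda>j::nat. (2 * real j + 1) * \<rho> - a) ` {..nat \<lfloor>a / \<rho>\<rfloor>}"
  show thesis
  proof (rule that)
    show "finite T" by (simp add: T_def)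
    have "card T \<le> nat \<lfloor>a / \<rho>\<rfloor> + 1"
      unfolding T_def by (rule order_trans[OF card_image_le]) auto
    moreover have "real (nat \<lfloor>a / \<rho>\<rfloor>) \<le> a / \<rho>" using assms by simp
    ultimately show "real (card T) \<le> 2 * max 1 (a / \<rho>)" by linarith
    fix x assume x: "\<bar>x\<bar> \<le> a"
    define j where "j = nat \<lfloor>(x + a) / (2 * \<rho>)\<rfloor>"
    have "(x + a) / (2 * \<rho>) \<le> a / \<rho>" using x assms by (simp add: field_simps)
    then have "j \<le> nat \<lfloor>a / \<rho>\<rfloor>" unfolding j_def by (intro nat_mono floor_mono)
    moreover have "0 \<le> (x + a) / (2 * \<rho>)" using x assms by (intro divide_nonneg_pos) auto
    then have "real j \<le> (x + a) / (2 * \<rho>)" "(x + a) / (2 * \<rho>) < real j + 1"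
      unfolding j_def by linarith+
    then have "\<bar>x - ((2 * real j + 1) * \<rho> - a)\<bar> \<le> \<rho>"
      using assms by (simp add: field_simps abs_le_iff)
    ultimately show "\<exists>t\<in>T. \<bar>x - t\<bar> \<le> \<rho>" unfolding T_def by blast
  qed
qed

text \<open>A product of interval nets along the frame \<open>f\<close>; by Pythagoras an error
  \<open>\<rho>\<close> in each coordinate becomes a distance of at most
  \<open>sqrt (card I) * \<rho>\<close>.\<close>

lemma box_net:
  fixes f :: "'i \<Rightarrow> 'a::euclidean_space"
  assumes f: "orthonormal_on I f" "finite I" "span (f ` I) = UNIV"
    and a: "\<And>i. i \<in> I \<Longrightarrow> 0 \<le> a i" and \<rho>: "0 < \<rho>"
  obtains P where "finite P" "real (card P) \<le> 2 ^ card I * (\<Prod>i\<in>I. max 1 (a i / \<rho>))"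
    "\<And>y. (\<And>i. i \<in> I \<Longrightarrow> \<bar>f i \<bullet> (y - z)\<bar> \<le> a i) \<Longrightarrow> \<exists>p\<in>P. dist y p \<le> sqrt (real (card I)) * \<rho>"
proof -
  have "\<forall>i. \<exists>T. i \<in> I \<longrightarrow> finite T \<and> real (card T) \<le> 2 * max 1 (a i / \<rho>) \<and>
      (\<forall>x. \<bar>x\<bar> \<le> a i \<longrightarrow> (\<exists>t\<in>T. \<bar>x - t\<bar> \<le> \<rho>))"
    using interval_net[OF a \<rho>] by metis
  then obtain T where T: "\<And>i. i \<in> I \<Longrightarrow> finite (T i)" "\<And>i. i \<in> I \<Longrightarrow> real (card (T i)) \<le> 2 * max 1 (a i / \<rho>)"
    "\<And>i x. i \<in> I \<Longrightarrow> \<bar>x\<bar> \<le> a i \<Longrightarrow> \<exists>t\<in>T i. \<bar>x - t\<bar> \<le> \<rho>" by metis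
  define P where "P = (\<lambda>t. z + (\<Sum>i\<in>I. t i *\<^sub>R f i)) ` (PiE I T)"
  have fin: "finite (PiE I T)" using f(2) T(1) by (rule finite_PiE)
  show thesis
  proof (rule that)
    show "finite P" using fin by (simp add: P_def)
    have "card P \<le> card (PiE I T)" unfolding P_def by (rule card_image_le[OF fin])
    also have "\<dots> = (\<Prod>i\<in>I. card (T i))" by (rule card_PiE[OF f(2)])
    finally have "real (card P) \<le> (\<Prod>i\<in>I. real (card (T i)))" by (metis of_nat_mono of_nat_prod)
    also have "\<dots> \<le> (\<Prod>i\<in>I. 2 * max 1 (a i / \<rho>))" using T(2) by (intro prod_mono) auto
    also have "\<dots> = 2 ^ card I * (\<Prod>i\<in>I. max 1 (a i / \<rho>))" by (simp add: prod.distrib)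
    finally show "real (card P) \<le> 2 ^ card I * (\<Prod>i\<in>I. max 1 (a i / \<rho>))" .
    fix y assume y: "\<And>i. i \<in> I \<Longrightarrow> \<bar>f i \<bullet> (y - z)\<bar> \<le> a i"
    then have "\<forall>i\<in>I. \<exists>t. t \<in> T i \<and> \<bar>f i \<bullet> (y - z) - t\<bar> \<le> \<rho>" using T(3) by blast
    then obtain t where t: "\<And>i. i \<in> I \<Longrightarrow> t i \<in> T i" "\<And>i. i \<in> I \<Longrightarrow> \<bar>f i \<bullet> (y - z) - t i\<bar> \<le> \<rho>" by metis
    \<comment> \<open>\<open>restrict\<close> puts the chosen coordinates into \<open>PiE\<close>,
      whose members are \<open>undefined\<close> off \<open>I\<close>.\<close>
    let ?p = "z + (\<Sum>i\<in>I. restrict t I i *\<^sub>R f i)"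
    have "y - ?p = (\<Sum>i\<in>I. (f i \<bullet> (y - z)) *\<^sub>R f i) - (\<Sum>i\<in>I. t i *\<^sub>R f i)"
      using orthonormal_on_expand[OF f(1,2), of "y - z"] f(3) by (simp add: algebra_simps)
    also have "\<dots> = (\<Sum>i\<in>I. (f i \<bullet> (y - z) - t i) *\<^sub>R f i)"
      by (simp add: sum_subtractf scaleR_left_diff_distrib)
    finally have eq: "y - ?p = (\<Sum>i\<in>I. (f i \<bullet> (y - z) - t i) *\<^sub>R f i)" .
    have "(dist y ?p)\<^sup>2 = (\<Sum>i\<in>I. (f i \<bullet> (y - z) - t i)\<^sup>2)"
      unfolding dist_norm eq power2_norm_eq_inner inner_orthonormal_sums[OF f(1,2)]
      by (simp add: power2_eq_square)
    also have "\<dots> \<le> (\<Sum>i\<in>I. \<rho>\<^sup>2)"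
      using t(2) \<rho> by (intro sum_mono) (simp add: abs_le_square_iff[symmetric])
    also have "\<dots> = (sqrt (real (card I)) * \<rho>)\<^sup>2" by (simp add: power_mult_distrib)
    finally have "dist y ?p \<le> sqrt (real (card I)) * \<rho>"
      using \<rho> by (rule_tac power2_le_imp_le) auto
    moreover have "?p \<in> P" unfolding P_def using t(1) by (intro imageI) auto
    ultimately show "\<exists>p\<in>P. dist y p \<le> sqrt (real (card I)) * \<rho>" by blast
  qed
qed

text \<open>The perturbed ellipsoid lies in a box with half-axes \<open>2 * \<sigma>\<^sub>i * r\<close> along the left
  singular vectors, which is cut into cubes of half-side \<open>2 * \<sigma>\<^sub>k\<^sub>+\<^sub>1 * r\<close>.\<close>

lemma ellipsoid_net:
  fixes A :: "real^'n^'n"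
  assumes A: "invertible A" and d: "0 < d" "d < real CARD('n)"
    and \<eta>: "0 \<le> \<eta>" "\<And>x. \<eta> * norm x \<le> norm (A *v x)" and r: "0 < r"
  obtains P R where "finite P" "0 < R"
    "real (card P) * R powr d \<le> 2 ^ CARD('n) * (2 * sqrt (real CARD('n))) powr d * exp (lsv d A) * r powr d"
    "R \<le> 2 * sqrt (real CARD('n)) * exp (lsv d A / d) * r"
    "\<And>x y. norm x \<le> r \<Longrightarrow> norm (y - z - A *v x) \<le> \<eta> * r \<Longrightarrow> \<exists>p\<in>P. dist y p \<le> R"
proof -
  let ?n = "CARD('n)" and ?\<sigma> = "singular_value A"
  obtain k \<theta> where k: "d = real k + \<theta>" "0 \<le> \<theta>" "\<theta> < 1" "k < ?n"
    using real_nat_frac_cases[of d ?n] d by (metis add.right_neutral less_irrefl less_imp_le)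
  obtain w :: "nat \<Rightarrow> real^'n" where w: "orthonormal_on {1..?n} w" "span (w ` {1..?n}) = UNIV"
    "\<And>i j. i \<in> {1..?n} \<Longrightarrow> j \<in> {1..?n} \<Longrightarrow> i \<noteq> j \<Longrightarrow> (A *v w i) \<bullet> (A *v w j) = 0"
    "\<And>i. i \<in> {1..?n} \<Longrightarrow> norm (A *v w i) = ?\<sigma> i"
    by (rule singular_value_decomposition[of A]) metis
  have pos: "0 < ?\<sigma> i" if "i \<in> {1..?n}" for i using singular_value_pos[OF A that] .
  define f where "f i = (A *v w i) /\<^sub>R ?\<sigma> i" for i
  have f: "orthonormal_on {1..?n} f"
    unfolding orthonormal_on_def
  proof (intro ballI)
    fix i j assume ij: "i \<in> {1..?n}" "j \<in> {1..?n}"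
    show "f i \<bullet> f j = (if i = j then 1 else 0)"
      using w(3)[OF ij] w(4)[OF ij(1)] pos[OF ij(1)]
      by (auto simp: f_def power2_norm_eq_inner[symmetric] power2_eq_square field_simps)
  qed
  have "dim (f ` {1..?n}) = ?n" using orthonormal_on_dim_span[OF f] by simp
  then have spanf: "span (f ` {1..?n}) = UNIV" using dim_eq_full[of "f ` {1..?n}"] by simp
  have fA: "f i \<bullet> (A *v x) = ?\<sigma> i * (w i \<bullet> x)" if i: "i \<in> {1..?n}" for i x
  proof -
    have "A *v x = A *v (\<Sum>l=1..?n. (w l \<bullet> x) *\<^sub>R w l)"
      using orthonormal_on_expand[OF w(1), of x] w(2) by simp
    also have "\<dots> = (\<Sum>l=1..?n. (w l \<bullet> x) *\<^sub>R (A *v w l))"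
      by (simp add: linear_sum[OF matrix_vector_mul_linear] matrix_vector_mult_scaleR)
    finally have "f i \<bullet> (A *v x) = (\<Sum>l=1..?n. (w l \<bullet> x) * (f i \<bullet> (A *v w l)))"
      by (simp add: inner_sum_right)
    also have "\<dots> = (\<Sum>l=1..?n. if l = i then (w i \<bullet> x) * ?\<sigma> i else 0)"
    proof (intro sum.cong refl)
      fix l assume l: "l \<in> {1..?n}"
      show "(w l \<bullet> x) * (f i \<bullet> (A *v w l)) = (if l = i then (w i \<bullet> x) * ?\<sigma> i else 0)"
        using w(3)[OF i l] w(4)[OF i] pos[OF i]
        by (auto simp: f_def power2_norm_eq_inner[symmetric] power2_eq_square)
    qed
    also have "\<dots> = ?\<sigma> i * (w i \<bullet> x)" using i by simp
    finally show ?thesis .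
  qed
  let ?s = "?\<sigma> (k + 1)"
  have s: "0 < ?s" using pos k by auto
  define \<rho> where "\<rho> = 2 * ?s * r"
  have \<rho>: "0 < \<rho>" using s r by (simp add: \<rho>_def)
  obtain P where P: "finite P" "real (card P) \<le> 2 ^ ?n * (\<Prod>i=1..?n. max 1 ((2 * ?\<sigma> i * r) / \<rho>))"
    "\<And>y. (\<And>i. i \<in> {1..?n} \<Longrightarrow> \<bar>f i \<bullet> (y - z)\<bar> \<le> 2 * ?\<sigma> i * r) \<Longrightarrow> \<exists>p\<in>P. dist y p \<le> sqrt (real ?n) * \<rho>"
    using box_net[OF f _ spanf, of "\<lambda>i. 2 * ?\<sigma> i * r" \<rho> z] \<rho> r pos by (auto simp: less_imp_le)
  \<comment> \<open>Past index k the half-axes are no longer than the cube's half-side, so only the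
    first k directions contribute to the count.\<close>
  have "(\<Prod>i=1..?n. max 1 ((2 * ?\<sigma> i * r) / \<rho>)) = (\<Prod>i=1..k. max 1 ((2 * ?\<sigma> i * r) / \<rho>))"
  proof (intro prod.mono_neutral_right ballI)
    fix i assume "i \<in> {1..?n} - {1..k}"
    then have "?\<sigma> i \<le> ?s" by (intro singular_value_antimono) auto
    then show "max 1 ((2 * ?\<sigma> i * r) / \<rho>) = 1" using s r by (simp add: \<rho>_def field_simps)
  qed (use k in auto)
  also have "\<dots> = (\<Prod>i=1..k. exp (ln (?\<sigma> i) - ln ?s))"
  proof (intro prod.cong refl)
    fix i assume i: "i \<in> {1..k}"
    then have "?s \<le> ?\<sigma> i" "0 < ?\<sigma> i" using k pos by (auto intro!: singular_value_antimono)
    then show "max 1 ((2 * ?\<sigma> i * r) / \<rho>) = exp (ln (?\<sigma> i) - ln ?s)"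
      using s r by (simp add: \<rho>_def exp_diff)
  qed
  also have "\<dots> = exp ((\<Sum>i=1..k. ln (?\<sigma> i)) - real k * ln ?s)"
    by (simp add: sum_subtractf flip: exp_sum)
  finally have card: "real (card P) \<le> 2 ^ ?n * exp ((\<Sum>i=1..k. ln (?\<sigma> i)) - real k * ln ?s)"
    using P(2) by simp
  have lsv: "lsv d A = (\<Sum>i=1..k. ln (?\<sigma> i)) + \<theta> * ln ?s"
    using lsv_eq[of \<theta> k A] k by simp
  \<comment> \<open>\<open>?s\<close> is the smallest of the singular values entering omega_d, whose
    exponents add up to d; hence its d-th power is at most omega_d, which bounds the radius.\<close>
  have "(\<Sum>i=1..k. ln ?s) \<le> (\<Sum>i=1..k. ln (?\<sigma> i))"
  proof (intro sum_mono)
    fix i assume "i \<in> {1..k}"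
    then show "ln ?s \<le> ln (?\<sigma> i)"
      using k s pos[of i] singular_value_antimono[of i "k + 1" A] by auto
  qed
  then have "d * ln ?s \<le> lsv d A" using lsv k by (simp add: algebra_simps)
  then have "ln ?s \<le> lsv d A / d" using d by (simp add: field_simps)
  then have s_le: "?s \<le> exp (lsv d A / d)" using s by (metis exp_le_cancel_iff exp_ln)
  define R where "R = 2 * sqrt (real ?n) * ?s * r"
  have R: "R = sqrt (real ?n) * \<rho>" by (simp add: R_def \<rho>_def)
  show thesis
  proof (rule that[OF P(1)])
    show "0 < R" using s r by (simp add: R_def)
    show "R \<le> 2 * sqrt (real ?n) * exp (lsv d A / d) * r"
      unfolding R_def using s_le r by (intro mult_right_mono mult_left_mono) auto
    have "R powr d = (2 * sqrt (real ?n)) powr d * exp (d * ln ?s) * r powr d"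
    proof -
      have "exp (d * ln ?s) = ?s powr d" using s by (simp add: powr_def)
      then show ?thesis using s r by (simp add: R_def powr_mult)
    qed
    then have "real (card P) * R powr d \<le>
        2 ^ ?n * exp ((\<Sum>i=1..k. ln (?\<sigma> i)) - real k * ln ?s) *
        ((2 * sqrt (real ?n)) powr d * exp (d * ln ?s) * r powr d)"
      using card by (simp add: mult_right_mono)
    also have "\<dots> = 2 ^ ?n * (2 * sqrt (real ?n)) powr d *
        exp ((\<Sum>i=1..k. ln (?\<sigma> i)) - real k * ln ?s + d * ln ?s) * r powr d"
      by (simp add: exp_add)
    \<comment> \<open>The count contributes \<open>?s\<close> to the power -k and the radius to the
      power d; their sum theta is exactly its exponent in omega_d.\<close>
    also have "(\<Sum>i=1..k. ln (?\<sigma> i)) - real k * ln ?s + d * ln ?s = lsv d A"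
      using lsv k by (simp add: algebra_simps)
    finally show "real (card P) * R powr d \<le>
      2 ^ ?n * (2 * sqrt (real ?n)) powr d * exp (lsv d A) * r powr d" .
    fix x y assume x: "norm x \<le> r" and y: "norm (y - z - A *v x) \<le> \<eta> * r"
    show "\<exists>p\<in>P. dist y p \<le> R"
      unfolding R
    proof (rule P(3))
      fix i assume i: "i \<in> {1..?n}"
      have "f i \<bullet> (y - z) = ?\<sigma> i * (w i \<bullet> x) + f i \<bullet> (y - z - A *v x)"
        using fA[OF i, of x] by (simp add: inner_diff_right)
      also have "\<bar>\<dots>\<bar> \<le> ?\<sigma> i * \<bar>w i \<bullet> x\<bar> + \<bar>f i \<bullet> (y - z - A *v x)\<bar>"
        using pos[OF i] by (intro order_trans[OF abs_triangle_ineq]) (simp add: abs_mult)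
      also have "\<bar>w i \<bullet> x\<bar> \<le> r"
        using Cauchy_Schwarz_ineq2[of "w i" x] orthonormal_on_norm[OF w(1) i] x by simp
      also have "\<bar>f i \<bullet> (y - z - A *v x)\<bar> \<le> \<eta> * r"
        using Cauchy_Schwarz_ineq2[of "f i" "y - z - A *v x"] orthonormal_on_norm[OF f i] y by simp
      \<comment> \<open>\<open>\<eta>\<close> lies below every singular value, so the error is
        absorbed in each direction, including the thinnest; this is the factor 2 in the
        half-axes.\<close>
      also have "\<eta> * r \<le> ?\<sigma> i * r"
        using singular_value_bounds(1)[OF i \<eta>(2)] r by (intro mult_right_mono) auto
      finally show "\<bar>f i \<bullet> (y - z)\<bar> \<le> 2 * ?\<sigma> i * r" using pos[OF i] by (simp add: ac_simps)
    qed
  qed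
qed

text \<open>Centres are required to lie in \<open>K\<close>, since the derivative estimates hold
  around points of \<open>K\<close>. The bound \<open>\<epsilon>\<close> controls the mesh and
  \<open>M\<close> the d-dimensional mass.\<close>

definition ball_cover :: "real \<Rightarrow> real \<Rightarrow> real \<Rightarrow> 'a::metric_space set \<Rightarrow> bool" where
  "ball_cover d \<epsilon> M K \<longleftrightarrow> (\<exists>F. finite F \<and> (\<forall>(p, r)\<in>F. p \<in> K \<and> 0 < r \<and> r \<le> \<epsilon>)
     \<and> K \<subseteq> (\<Union>(p, r)\<in>F. cball p r) \<and> (\<Sum>(p, r)\<in>F. r powr d) \<le> M)"

lemma diameter_cball_le:
  fixes p :: "'a::metric_space" assumes "0 \<le> r" shows "diameter (cball p r) \<le> 2 * r"
proof -
  have "dist x y \<le> 2 * r" if "x \<in> cball p r" "y \<in> cball p r" for x y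
    using that dist_triangle[of x y p] by (simp add: dist_commute)
  then show ?thesis using assms by (auto simp: diameter_def intro!: cSUP_least)
qed

lemma ball_coverE:
  assumes "ball_cover d \<epsilon> M K"
  obtains F where "finite F" "\<And>p r. (p, r) \<in> F \<Longrightarrow> p \<in> K \<and> 0 < r \<and> r \<le> \<epsilon>"
    "K \<subseteq> (\<Union>(p, r)\<in>F. cball p r)" "(\<Sum>(p, r)\<in>F. r powr d) \<le> M"
proof -
  from assms obtain F where F: "finite F \<and> (\<forall>(p, r)\<in>F. p \<in> K \<and> 0 < r \<and> r \<le> \<epsilon>)
     \<and> K \<subseteq> (\<Union>(p, r)\<in>F. cball p r) \<and> (\<Sum>(p, r)\<in>F. r powr d) \<le> M"
    unfolding ball_cover_def by (elim exE)
  show thesis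
  proof (rule that[of F])
    show "p \<in> K \<and> 0 < r \<and> r \<le> \<epsilon>" if "(p, r) \<in> F" for p r
      using F that by blast
  qed (insert F, (elim conjE, assumption)+)
qed

lemma hausdorff_premeasure_le:
  fixes K :: "'a::metric_space set"
  assumes d: "0 < d" and cov: "ball_cover d \<epsilon> M K" and \<epsilon>: "2 * \<epsilon> \<le> \<delta>" "0 < \<delta>"
  shows "hausdorff_premeasure d \<delta> K \<le> ennreal (2 powr d * M)"
proof -
  from cov obtain F where F: "finite F" "\<And>p r. (p, r) \<in> F \<Longrightarrow> p \<in> K \<and> 0 < r \<and> r \<le> \<epsilon>"
    "K \<subseteq> (\<Union>(p, r)\<in>F. cball p r)" "(\<Sum>(p, r)\<in>F. r powr d) \<le> M"
    by (rule ball_coverE) (rule that)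
  obtain h where h: "bij_betw h {..<card F} F"
    using finite_same_card_bij[of "{..<card F}" F] F(1) by auto
  \<comment> \<open>The finite cover is padded to a sequence by empty sets, which
    \<open>diam_pow\<close> counts as 0.\<close>
  define C where "C i = (if i < card F then cball (fst (h i)) (snd (h i)) else {})" for i
  have hF: "0 < snd (h i) \<and> snd (h i) \<le> \<epsilon>" if "i < card F" for i
    using F(2)[of "fst (h i)" "snd (h i)"] bij_betwE[OF h] that by auto
  have diam: "diameter (C i) \<le> 2 * snd (h i)" if "i < card F" for i
    using diameter_cball_le[of "snd (h i)" "fst (h i)"] hF[OF that] that by (simp add: C_def)
  have "(\<Union>i. C i) = (\<Union>i<card F. cball (fst (h i)) (snd (h i)))"
    by (auto simp: C_def split: if_splits)
  also have "\<dots> = (\<Union>q\<in>h ` {..<card F}. cball (fst q) (snd q))" by simp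
  also have "h ` {..<card F} = F" by (rule bij_betw_imp_surj_on[OF h])
  finally have "K \<subseteq> (\<Union>i. C i)" using F(3) by (simp only: case_prod_unfold)
  moreover have "bounded (C i) \<and> diameter (C i) \<le> \<delta>" for i
    using diam[of i] hF[of i] \<epsilon> by (cases "i < card F") (auto simp: C_def)
  ultimately have "hausdorff_premeasure d \<delta> K \<le> (\<Sum>i. ennreal (diam_pow d (C i)))"
    unfolding hausdorff_premeasure_def by (intro INF_lower) auto
  also have "\<dots> = (\<Sum>i<card F. ennreal (diam_pow d (C i)))"
    by (rule suminf_finite) (auto simp: C_def diam_pow_def)
  also have "\<dots> \<le> (\<Sum>i<card F. ennreal (2 powr d * snd (h i) powr d))"
  proof (intro sum_mono ennreal_leI)
    fix i assume i: "i \<in> {..<card F}"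
    have "diameter (C i) powr d \<le> (2 * snd (h i)) powr d"
      using diam[of i] i d diameter_ge_0[of "C i"]
      by (intro powr_mono2) (auto simp: C_def)
    then show "diam_pow d (C i) \<le> 2 powr d * snd (h i) powr d"
      using d hF[of i] i by (auto simp: diam_pow_def powr_mult)
  qed
  also have "\<dots> = ennreal (\<Sum>i<card F. 2 powr d * snd (h i) powr d)"
    by (rule sum_ennreal) auto
  also have "(\<Sum>i<card F. 2 powr d * snd (h i) powr d) = (\<Sum>q\<in>F. 2 powr d * snd q powr d)"
    by (rule sum.reindex_bij_betw[OF h])
  also have "\<dots> = 2 powr d * (\<Sum>(p, r)\<in>F. r powr d)"
    by (simp add: sum_distrib_left case_prod_beta)
  also have "ennreal \<dots> \<le> ennreal (2 powr d * M)"
    using F(4) by (intro ennreal_leI mult_left_mono) auto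
  finally show ?thesis .
qed

lemma hausdorff_measure_eq_0I:
  fixes K :: "'a::metric_space set"
  assumes d: "0 < d" and cov: "\<And>e. 0 < e \<Longrightarrow> ball_cover d e e K"
  shows "hausdorff_measure d K = 0"
proof -
  have "hausdorff_premeasure d \<delta> K \<le> 0 + ennreal e" if "\<delta> > 0" "e > 0" for \<delta> e
  proof -
    define e' where "e' = min (\<delta> / 2) (e / 2 powr d)"
    have e': "0 < e'" "2 * e' \<le> \<delta>" "2 powr d * e' \<le> e"
      using that by (auto simp: e'_def min_def field_simps)
    have "hausdorff_premeasure d \<delta> K \<le> ennreal (2 powr d * e')"
      by (rule hausdorff_premeasure_le[OF d cov[OF e'(1)] e'(2) that(1)])
    also have "\<dots> \<le> ennreal e" using e'(3) by (rule ennreal_leI)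
    finally show ?thesis by simp
  qed
  then have "hausdorff_premeasure d \<delta> K = 0" if "\<delta> > 0" for \<delta>
    using that by (metis ennreal_le_epsilon le_zero_eq)
  then show ?thesis unfolding hausdorff_measure_def by (simp add: SUP_eq_const)
qed

text \<open>Net points of an ellipsoid may lie off \<open>K\<close>, whereas the iteration needs
  centres in \<open>K\<close>. Points that serve nothing in \<open>X\<close> are dropped and the
  others moved into \<open>X\<close>, at the price of doubling the radius.\<close>

lemma recentre_net:
  fixes K :: "'a::metric_space set"
  assumes "finite P" "X \<subseteq> K" "\<And>y. y \<in> X \<Longrightarrow> \<exists>p\<in>P. dist y p \<le> R"
  obtains Q where "finite Q" "Q \<subseteq> K" "card Q \<le> card P" "X \<subseteq> (\<Union>q\<in>Q. cball q (2 * R))"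
proof -
  define P' where "P' = {p\<in>P. \<exists>y\<in>X. dist y p \<le> R}"
  have "\<forall>p\<in>P'. \<exists>y. y \<in> X \<and> dist y p \<le> R" by (auto simp: P'_def)
  then obtain g where g: "\<And>p. p \<in> P' \<Longrightarrow> g p \<in> X \<and> dist (g p) p \<le> R" by metis
  have P': "finite P'" "P' \<subseteq> P" using assms(1) by (auto simp: P'_def)
  show thesis
  proof (rule that[of "g ` P'"])
    show "card (g ` P') \<le> card P"
      using card_image_le[OF P'(1), of g] card_mono[OF assms(1) P'(2)] by simp
    show "X \<subseteq> (\<Union>q\<in>g ` P'. cball q (2 * R))"
    proof
      fix y assume y: "y \<in> X"
      then obtain p where p: "p \<in> P" "dist y p \<le> R" using assms(3) by blast
      then have "p \<in> P'" using y by (auto simp: P'_def)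
      moreover have "dist (g p) y \<le> 2 * R"
        using g[OF calculation] p(2) dist_triangle[of "g p" y p] by (simp add: dist_commute)
      ultimately show "y \<in> (\<Union>q\<in>g ` P'. cball q (2 * R))" by auto
    qed
  qed (use P' g assms(2) in auto)
qed

lemma ball_cover_step:
  fixes K :: "'a::metric_space set" and g :: "'a \<Rightarrow> 'a"
  assumes K: "K \<subseteq> g ` K"
    and step: "\<And>p r. p \<in> K \<Longrightarrow> 0 < r \<Longrightarrow> r \<le> r0 \<Longrightarrow> \<exists>Q R. finite Q \<and> Q \<subseteq> K \<and> 0 < R \<and> R \<le> r / 2
       \<and> real (card Q) * R powr d \<le> r powr d / 2 \<and> g ` (K \<inter> cball p r) \<subseteq> (\<Union>q\<in>Q. cball q R)"
    and cov: "ball_cover d \<epsilon> M K" and \<epsilon>: "\<epsilon> \<le> r0"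
  shows "ball_cover d (\<epsilon> / 2) (M / 2) K"
proof -
  from cov obtain F where F: "finite F" "\<And>p r. (p, r) \<in> F \<Longrightarrow> p \<in> K \<and> 0 < r \<and> r \<le> \<epsilon>"
    "K \<subseteq> (\<Union>(p, r)\<in>F. cball p r)" "(\<Sum>(p, r)\<in>F. r powr d) \<le> M"
    by (rule ball_coverE) (rule that)
  define good where "good f Q R \<longleftrightarrow> finite Q \<and> Q \<subseteq> K \<and> 0 < R \<and> R \<le> snd f / 2
      \<and> real (card Q) * R powr d \<le> snd f powr d / 2
      \<and> g ` (K \<inter> cball (fst f) (snd f)) \<subseteq> (\<Union>q\<in>Q. cball q R)" for f Q R
  have "\<exists>Q R. good f Q R" if "f \<in> F" for f
    unfolding good_def using F(2)[of "fst f" "snd f"] that \<epsilon> by (intro step) auto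
  then obtain Q R where "\<And>f. f \<in> F \<Longrightarrow> good f (Q f) (R f)" by metis
  then have Q: "finite (Q f)" "Q f \<subseteq> K" "0 < R f" "R f \<le> snd f / 2"
    "real (card (Q f)) * R f powr d \<le> snd f powr d / 2"
    "g ` (K \<inter> cball (fst f) (snd f)) \<subseteq> (\<Union>q\<in>Q f. cball q (R f))" if "f \<in> F" for f
    using that unfolding good_def by simp_all
  define G where "G = (\<lambda>(f, q). (q, R f)) ` (SIGMA f:F. Q f)"
  have fin: "finite (SIGMA f:F. Q f)" using F(1) Q(1) by auto
  show ?thesis
    unfolding ball_cover_def
  proof (intro exI[of _ G] conjI)
    show "finite G" using fin by (simp add: G_def)
    show "\<forall>(p, r)\<in>G. p \<in> K \<and> 0 < r \<and> r \<le> \<epsilon> / 2"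
    proof clarify
      fix p r assume "(p, r) \<in> G"
      then obtain f where f: "f \<in> F" "p \<in> Q f" "r = R f" by (auto simp: G_def)
      then show "p \<in> K \<and> 0 < r \<and> r \<le> \<epsilon> / 2"
        using Q(2-4)[OF f(1)] F(2)[of "fst f" "snd f"] by auto
    qed
    show "K \<subseteq> (\<Union>(p, r)\<in>G. cball p r)"
    proof
      fix y assume "y \<in> K"
      then obtain x where x: "x \<in> K" "y = g x" using K by blast
      then obtain f where f: "f \<in> F" "x \<in> cball (fst f) (snd f)"
        using F(3) by (auto simp: case_prod_beta)
      then have "y \<in> (\<Union>q\<in>Q f. cball q (R f))" using Q(6)[OF f(1)] x by blast
      then show "y \<in> (\<Union>(p, r)\<in>G. cball p r)" using f(1) by (force simp: G_def)
    qed
    \<comment> \<open>Only an inequality: different old balls may produce the same new ball, which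
      the set \<open>G\<close> counts once.\<close>
    have "(\<Sum>(p, r)\<in>G. r powr d) \<le> (\<Sum>z\<in>(SIGMA f:F. Q f). (\<lambda>(p, r). r powr d) ((\<lambda>(f, q). (q, R f)) z))"
      unfolding G_def by (rule sum_image_le[OF fin, unfolded comp_def]) auto
    also have "\<dots> = (\<Sum>(f, q)\<in>(SIGMA f:F. Q f). R f powr d)"
      by (intro sum.cong) auto
    also have "\<dots> = (\<Sum>f\<in>F. \<Sum>q\<in>Q f. R f powr d)"
      using F(1) Q(1) by (intro sum.Sigma[symmetric]) auto
    also have "\<dots> \<le> (\<Sum>f\<in>F. snd f powr d / 2)"
      using Q(5) by (intro sum_mono) simp
    also have "\<dots> = (\<Sum>(p, r)\<in>F. r powr d) / 2"
      by (simp add: sum_divide_distrib case_prod_beta)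
    also have "\<dots> \<le> M / 2" using F(4) by simp
    finally show "(\<Sum>(p, r)\<in>G. r powr d) \<le> M / 2" .
  qed
qed

lemma ball_cover_mono: "ball_cover d \<epsilon> M K \<Longrightarrow> \<epsilon> \<le> \<epsilon>' \<Longrightarrow> M \<le> M' \<Longrightarrow> ball_cover d \<epsilon>' M' K"
  unfolding ball_cover_def by (elim exE) (rule exI, fastforce)

lemma hausdorff_measure_eq_0_by_contraction:
  fixes K :: "'a::metric_space set" and g :: "'a \<Rightarrow> 'a"
  assumes K: "compact K" "K \<subseteq> g ` K" and d: "0 < d" and r0: "0 < r0"
    and step: "\<And>p r. p \<in> K \<Longrightarrow> 0 < r \<Longrightarrow> r \<le> r0 \<Longrightarrow> \<exists>Q R. finite Q \<and> Q \<subseteq> K \<and> 0 < R \<and> R \<le> r / 2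
       \<and> real (card Q) * R powr d \<le> r powr d / 2 \<and> g ` (K \<inter> cball p r) \<subseteq> (\<Union>q\<in>Q. cball q R)"
  shows "hausdorff_measure d K = 0"
proof (rule hausdorff_measure_eq_0I[OF d])
  obtain C where C: "C \<subseteq> K" "finite C" "K \<subseteq> (\<Union>c\<in>C. ball c r0)"
  proof (rule compactE_image[OF K(1), of K "\<lambda>c. ball c r0"])
    show "K \<subseteq> (\<Union>c\<in>K. ball c r0)" using r0 by force
  qed auto
  define M where "M = real (card C) * r0 powr d"
  have M: "0 \<le> M" by (simp add: M_def)
  have base: "ball_cover d r0 M K"
    unfolding ball_cover_def
  proof (intro exI[of _ "(\<lambda>c. (c, r0)) ` C"] conjI)
    show "(\<Sum>(p, r)\<in>(\<lambda>c. (c, r0)) ` C. r powr d) \<le> M"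
      by (subst sum.reindex) (auto simp: inj_on_def M_def)
    show "K \<subseteq> (\<Union>(p, r)\<in>(\<lambda>c. (c, r0)) ` C. cball p r)"
      using C(3) by (rule order_trans) (auto simp: image_iff)
  qed (use C r0 in auto)
  have iter: "ball_cover d (r0 / 2 ^ m) (M / 2 ^ m) K" for m
  proof (induction m)
    case (Suc m)
    have "r0 / 2 ^ m \<le> r0" using r0 by (simp add: field_simps)
    from ball_cover_step[OF K(2) step Suc this] show ?case by (simp add: field_simps)
  qed (use base in simp)
  fix e :: real assume e: "0 < e"
  obtain m where m: "(1/2) ^ m < e / (r0 + M)"
    using real_arch_pow_inv[of "e / (r0 + M)" "1/2"] e r0 M by auto
  then have "(r0 + M) / 2 ^ m < e" using r0 M by (simp add: field_simps)
  moreover have "r0 / 2 ^ m \<ge> 0" "M / 2 ^ m \<ge> 0" using r0 M by auto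
  ultimately have "r0 / 2 ^ m \<le> e" "M / 2 ^ m \<le> e" by (auto simp: add_divide_distrib)
  then show "ball_cover d e e K" by (rule ball_cover_mono[OF iter])
qed

text \<open>A grid of width \<open>\<rho>\<close> needs a number of cubes of order
  \<open>\<rho>\<close> to the power -n, and d > n makes the resulting d-dimensional mass tend to
  0.\<close>

lemma hausdorff_measure_bounded_eq_0:
  fixes K :: "(real^'n) set"
  assumes K: "bounded K" and d: "real CARD('n) < d"
  shows "hausdorff_measure d K = 0"
proof (rule hausdorff_measure_eq_0I)
  let ?n = "CARD('n)"
  show "0 < d" using d by simp
  fix e :: real assume e: "0 < e"
  obtain a where a: "0 < a" "\<And>x. x \<in> K \<Longrightarrow> norm x \<le> a" using K by (auto simp: bounded_pos)
  \<comment> \<open>The decomposition of the identity matrix serves as a source of an orthonormal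
    basis.\<close>
  obtain w :: "nat \<Rightarrow> real^'n" where w: "orthonormal_on {1..?n} w" "span (w ` {1..?n}) = UNIV"
    by (rule singular_value_decomposition[of "mat 1 :: real^'n^'n"]) metis
  define c where "c = 2 ^ ?n * a ^ ?n * (2 * sqrt (real ?n)) powr d"
  have c: "0 < c" using a by (simp add: c_def)
  have "((\<lambda>\<rho>. c * \<rho> powr (d - real ?n)) \<longlongrightarrow> c * 0 powr (d - real ?n)) (at_right 0)"
    using d by (intro tendsto_intros tendsto_powr') (auto simp: eventually_at_right_less intro: eventually_at_rightI[of 0 1])
  then have "eventually (\<lambda>\<rho>. c * \<rho> powr (d - real ?n) < e) (at_right 0)"
    using e d by (intro order_tendstoD(2)) auto
  moreover have "eventually (\<lambda>\<rho>. \<rho> < min a (e / (2 * sqrt (real ?n)))) (at_right (0::real))"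
    using a e by (intro eventually_at_rightI[of 0 "min a (e / (2 * sqrt (real ?n)))"]) auto
  moreover have "eventually (\<lambda>\<rho>. \<rho> > 0) (at_right (0::real))" by (rule eventually_at_right_less)
  ultimately have "eventually (\<lambda>\<rho>. c * \<rho> powr (d - real ?n) < e \<and> \<rho> < min a (e / (2 * sqrt (real ?n))) \<and> \<rho> > 0) (at_right 0)"
    by eventually_elim auto
  then obtain \<rho> where \<rho>: "c * \<rho> powr (d - real ?n) < e" "\<rho> < a" "\<rho> < e / (2 * sqrt (real ?n))" "0 < \<rho>"
    using eventually_happens' trivial_limit_at_right_real by fastforce
  obtain P where P: "finite P" "real (card P) \<le> 2 ^ ?n * (\<Prod>i=1..?n. max 1 (a / \<rho>))"
    "\<And>y. (\<And>i. i \<in> {1..?n} \<Longrightarrow> \<bar>w i \<bullet> (y - 0)\<bar> \<le> a) \<Longrightarrow> \<exists>p\<in>P. dist y p \<le> sqrt (real ?n) * \<rho>"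
    using box_net[OF w(1) _ w(2), of "\<lambda>_. a" \<rho> 0] a \<rho> by auto
  have "\<exists>p\<in>P. dist y p \<le> sqrt (real ?n) * \<rho>" if y: "y \<in> K" for y
  proof (rule P(3))
    fix i assume i: "i \<in> {1..?n}"
    show "\<bar>w i \<bullet> (y - 0)\<bar> \<le> a"
      using Cauchy_Schwarz_ineq2[of "w i" y] orthonormal_on_norm[OF w(1) i] a(2)[OF y] by simp
  qed
  from recentre_net[OF P(1) order_refl this] obtain Q where Q: "finite Q" "Q \<subseteq> K" "card Q \<le> card P"
    "K \<subseteq> (\<Union>q\<in>Q. cball q (2 * (sqrt (real ?n) * \<rho>)))" by metis
  define R where "R = 2 * sqrt (real ?n) * \<rho>"
  have R: "0 < R" "R \<le> e" using \<rho> by (auto simp: R_def field_simps)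
  have "real (card Q) \<le> 2 ^ ?n * (a / \<rho>) ^ ?n" using Q(3) P(2) \<rho> by (simp add: max_def)
  then have "real (card Q) * R powr d \<le> 2 ^ ?n * (a / \<rho>) ^ ?n * R powr d"
    by (intro mult_right_mono) auto
  also have "\<dots> = c * \<rho> powr (d - real ?n)"
    using \<rho> by (simp add: c_def R_def powr_mult powr_diff powr_realpow power_divide)
  finally have "real (card Q) * R powr d \<le> e" using \<rho>(1) by simp
  moreover have "(\<Sum>(p, r)\<in>(\<lambda>c. (c, R)) ` Q. r powr d) = real (card Q) * R powr d"
    by (subst sum.reindex) (auto simp: inj_on_def)
  moreover have "K \<subseteq> (\<Union>(p, r)\<in>(\<lambda>c. (c, R)) ` Q. cball p r)" using Q(4) by (auto simp: R_def mult.assoc)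
  ultimately show "ball_cover d e e K"
    unfolding ball_cover_def using Q(1,2) R by (intro exI[of _ "(\<lambda>c. (c, R)) ` Q"]) auto
qed

section \<open>Invariant sets of smooth maps\<close>

lemma jacobian_eqI:
  fixes f :: "real^'n \<Rightarrow> real^'n"
  assumes "(f has_derivative (\<lambda>h. A *v h)) (at u)" shows "jacobian f (at u) = A"
  using frechet_derivative_at[OF assms] matrix_of_matrix_vector_mul[of A]
  by (simp add: jacobian_def)

section \<open>Local Lyapunov dimension and the sign of \<open>lsv\<close>\<close>

lemma local_lyapunov_dim_bounds:
  fixes f :: "real^'n \<Rightarrow> real^'n"
  shows "0 \<le> local_lyapunov_dim f u" "local_lyapunov_dim f u \<le> real CARD('n)"
proof -
  let ?D = "{d \<in> {0..real CARD('n)}. sv_function d (jacobian f (at u)) < 1}"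
  have "0 \<le> Inf ?D \<and> Inf ?D \<le> real CARD('n)" if "?D \<noteq> {}"
  proof
    show "0 \<le> Inf ?D" using that by (intro cInf_greatest) auto
    from that obtain d where d: "d \<in> ?D" by auto
    then have "Inf ?D \<le> d" by (intro cInf_lower bdd_belowI[of _ 0]) auto
    then show "Inf ?D \<le> real CARD('n)" using d by auto
  qed
  then show "0 \<le> local_lyapunov_dim f u" "local_lyapunov_dim f u \<le> real CARD('n)"
    by (auto simp: local_lyapunov_dim_def Let_def)
qed

lemma local_lyapunov_dim_le:
  fixes f :: "real^'n \<Rightarrow> real^'n"
  assumes "invertible (jacobian f (at u))" "0 \<le> d" "d \<le> real CARD('n)"
    and "lsv d (jacobian f (at u)) < 0"
  shows "local_lyapunov_dim f u \<le> d"
proof -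
  let ?D = "{d \<in> {0..real CARD('n)}. sv_function d (jacobian f (at u)) < 1}"
  have d: "d \<in> ?D" using assms by (simp add: sv_function_eq_exp_lsv)
  then have "Inf ?D \<le> d" by (intro cInf_lower bdd_belowI[of _ 0]) auto
  then show ?thesis using d by (auto simp: local_lyapunov_dim_def Let_def)
qed

text \<open>The infimum supplies an admissible exponent below d, and
  \<open>lsv_negative_upward\<close> carries negativity up to d. The empty set is excluded because
  its default value n is not below d.\<close>

lemma lsv_negative_if_local_lyapunov_dim_less:
  fixes f :: "real^'n \<Rightarrow> real^'n"
  assumes inv: "invertible (jacobian f (at u))" and less: "local_lyapunov_dim f u < d" and d: "d \<le> real CARD('n)"
  shows "lsv d (jacobian f (at u)) < 0"
proof -
  let ?D = "{d \<in> {0..real CARD('n)}. sv_function d (jacobian f (at u)) < 1}"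
  have ne: "?D \<noteq> {}" using less d unfolding local_lyapunov_dim_def Let_def by (auto split: if_splits)
  have "Inf ?D < d"
    using less ne unfolding local_lyapunov_dim_def Let_def by (simp only: if_False)
  from cInf_lessD[OF ne this] obtain d' where d': "d' \<in> ?D" "d' < d" by auto
  then have "lsv d' (jacobian f (at u)) < 0" using sv_function_eq_exp_lsv[OF inv, of d'] by simp
  then show ?thesis using lsv_negative_upward[OF inv] d'(2) by simp
qed

text \<open>The assumptions are stable under composition, so each iterate is again an instance with
  the same \<open>U\<close> and \<open>K\<close>, and results for one map apply to all
  iterates.\<close>

locale smooth_system =
  fixes \<phi> :: "real^'n \<Rightarrow> real^'n" and U K :: "(real^'n) set"
  assumes open_U: "open U" and maps_U: "\<phi> ` U \<subseteq> U"
    and differentiable: "\<phi> differentiable_on U"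
    and continuous_jacobian: "continuous_on U (\<lambda>u. jacobian \<phi> (at u))"
    and invertible_jacobian: "\<And>u. u \<in> U \<Longrightarrow> invertible (jacobian \<phi> (at u))"
    and K_subset: "K \<subseteq> U" and K_nonempty: "K \<noteq> {}" and compact_K: "compact K"
    and invariant: "\<phi> ` K = K"
begin

section \<open>Derivatives of compositions and iterates, with uniform estimates near
  \<open>K\<close>\<close>

lemma has_derivative:
  assumes "u \<in> U" shows "(\<phi> has_derivative (\<lambda>h. jacobian \<phi> (at u) *v h)) (at u)"
proof (rule iffD1[OF jacobian_works])
  show "\<phi> differentiable (at u)"
    using differentiable differentiable_on_eq_differentiable_at[OF open_U] assms by blast
qed

lemma continuous: "continuous_on U \<phi>"
  by (rule differentiable_imp_continuous_on[OF differentiable])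

lemma jacobian_compose:
  assumes "smooth_system \<psi> U K" "u \<in> U"
  shows "((\<phi> \<circ> \<psi>) has_derivative (\<lambda>h. (jacobian \<phi> (at (\<psi> u)) ** jacobian \<psi> (at u)) *v h)) (at u)"
    and "jacobian (\<phi> \<circ> \<psi>) (at u) = jacobian \<phi> (at (\<psi> u)) ** jacobian \<psi> (at u)"
proof -
  interpret \<psi>: smooth_system \<psi> U K by fact
  have "\<psi> u \<in> U" using \<psi>.maps_U assms(2) by auto
  from diff_chain_at[OF \<psi>.has_derivative[OF assms(2)] has_derivative[OF this]]
  show 1: "((\<phi> \<circ> \<psi>) has_derivative (\<lambda>h. (jacobian \<phi> (at (\<psi> u)) ** jacobian \<psi> (at u)) *v h)) (at u)"
    by (simp add: comp_def matrix_vector_mul_assoc)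
  show "jacobian (\<phi> \<circ> \<psi>) (at u) = jacobian \<phi> (at (\<psi> u)) ** jacobian \<psi> (at u)"
    by (rule jacobian_eqI[OF 1])
qed

lemma compose:
  assumes "smooth_system \<psi> U K" shows "smooth_system (\<phi> \<circ> \<psi>) U K"
proof -
  interpret \<psi>: smooth_system \<psi> U K by fact
  note c = jacobian_compose[OF assms]
  show ?thesis
  proof
    show "(\<phi> \<circ> \<psi>) differentiable_on U"
      using c(1) by (auto simp: differentiable_on_def differentiable_def intro: has_derivative_at_withinI)
    have "continuous_on U (\<lambda>u. jacobian \<phi> (at (\<psi> u)))"
      using continuous_on_compose2[OF continuous_jacobian \<psi>.continuous] \<psi>.maps_U by blast
    then have "continuous_on U (\<lambda>u. jacobian \<phi> (at (\<psi> u)) ** jacobian \<psi> (at u))"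
      using \<psi>.continuous_jacobian
      unfolding matrix_matrix_mult_def
      by (intro continuous_intros)
    then show "continuous_on U (\<lambda>u. jacobian (\<phi> \<circ> \<psi>) (at u))"
      by (subst continuous_on_cong[OF refl c(2)])
    show "invertible (jacobian (\<phi> \<circ> \<psi>) (at u))" if "u \<in> U" for u
      using that \<psi>.maps_U c(2)[OF that]
      by (auto intro!: invertible_mult invertible_jacobian \<psi>.invertible_jacobian)
    show "(\<phi> \<circ> \<psi>) ` U \<subseteq> U" using maps_U \<psi>.maps_U by auto
    show "(\<phi> \<circ> \<psi>) ` K = K" using invariant \<psi>.invariant by (metis image_comp)
  qed (use open_U K_subset K_nonempty compact_K in auto)
qed

lemma jacobian_id: "jacobian id (at u) = mat 1" for u :: "real^'n"
  by (rule jacobian_eqI) (simp add: id_def)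

lemma iterate: "smooth_system (\<phi> ^^ t) U K"
proof (induction t)
  case 0
  show ?case
  proof
    show "(\<phi> ^^ 0) differentiable_on U" by (simp add: id_def)
    show "continuous_on U (\<lambda>u. jacobian (\<phi> ^^ 0) (at u))" by (simp add: jacobian_id)
    show "invertible (jacobian (\<phi> ^^ 0) (at u))" for u
      by (auto simp: jacobian_id invertible_def intro: exI[of _ "mat 1"])
  qed (use open_U K_subset K_nonempty compact_K in auto)
next
  case (Suc t)
  from compose[OF this] show ?case by (simp only: funpow.simps)
qed

lemma jacobian_iterate_Suc:
  assumes "u \<in> U"
  shows "jacobian (\<phi> ^^ Suc t) (at u) = jacobian \<phi> (at ((\<phi> ^^ t) u)) ** jacobian (\<phi> ^^ t) (at u)"
  using jacobian_compose(2)[OF iterate assms] by simp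

lemma iterate_in_K: "u \<in> K \<Longrightarrow> (\<phi> ^^ t) u \<in> K"
  using smooth_system.invariant[OF iterate, of t] by blast

text \<open>The segment from u to v may leave \<open>K\<close>, so uniform continuity of the
  Jacobian is taken on a compact neighbourhood inside \<open>U\<close>, and the mean value
  inequality on a convex ball in it.\<close>

lemma linearization:
  assumes "0 < \<eta>"
  obtains r0 where "0 < r0" "\<And>u v. u \<in> K \<Longrightarrow> dist u v \<le> r0 \<Longrightarrow>
    norm (\<phi> v - \<phi> u - jacobian \<phi> (at u) *v (v - u)) \<le> \<eta> * norm (v - u)"
proof -
  let ?J = "\<lambda>u. jacobian \<phi> (at u)"
  obtain \<delta> where \<delta>: "0 < \<delta>" "(\<Union>x\<in>K. cball x \<delta>) \<subseteq> U"
    using compact_subset_open_imp_cball_epsilon_subset[OF compact_K open_U K_subset] by metis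
  let ?K = "\<Union>x\<in>K. cball x \<delta>"
  have "compact ?K" by (rule compact_minkowski_sum_cball[OF compact_K])
  then have "uniformly_continuous_on ?K ?J"
    by (intro compact_uniformly_continuous continuous_on_subset[OF continuous_jacobian \<delta>(2)])
  then obtain r where r: "0 < r"
    "\<And>u v. u \<in> ?K \<Longrightarrow> v \<in> ?K \<Longrightarrow> dist v u < r \<Longrightarrow> dist (?J v) (?J u) < \<eta>"
    unfolding uniformly_continuous_on_def using assms by metis
  define r0 where "r0 = min \<delta> (r / 2)"
  show thesis
  proof
    show "0 < r0" using \<delta> r by (simp add: r0_def)
    fix u v assume u: "u \<in> K" and v: "dist u v \<le> r0"
    have sub: "cball u r0 \<subseteq> ?K" using u by (force simp: r0_def)
    have "norm (\<phi> v - \<phi> u - ?J u *v (v - u)) \<le> norm (v - u) * \<eta>"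
    proof (rule differentiable_bound_linearization[where S = "cball u r0" and f' = "\<lambda>x h. ?J x *v h"])
      show "u + t *\<^sub>R (v - u) \<in> cball u r0" if "t \<in> {0..1}" for t
      proof -
        have "t * norm (v - u) \<le> 1 * norm (v - u)" using that by (intro mult_right_mono) auto
        then show ?thesis using that v by (simp add: dist_norm norm_minus_commute)
      qed
      show "(\<phi> has_derivative (\<lambda>h. ?J x *v h)) (at x within cball u r0)" if "x \<in> cball u r0" for x
        using has_derivative[of x] sub \<delta>(2) that by (blast intro: has_derivative_at_withinI)
      show "onorm ((\<lambda>h. ?J x *v h) - (\<lambda>h. ?J u *v h)) \<le> \<eta>" if x: "x \<in> cball u r0" for x
      proof (rule onorm_le)
        fix h :: "real^'n"
        have "dist x u < r" using x r(1) by (simp add: r0_def dist_commute)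
        then have "norm (?J x - ?J u) \<le> \<eta>"
          using r(2)[of u x] sub x u \<delta>(1) by (force simp: dist_norm)
        then have "norm (?J x - ?J u) * norm h \<le> \<eta> * norm h" by (intro mult_right_mono) auto
        then show "norm (((\<lambda>h. ?J x *v h) - (\<lambda>h. ?J u *v h)) h) \<le> \<eta> * norm h"
          using norm_matrix_vector_le[of "?J x - ?J u" h]
          by (simp add: matrix_vector_mult_diff_rdistrib)
      qed
      show "u \<in> cball u r0" using \<delta> r by (simp add: r0_def)
    qed
    then show "norm (\<phi> v - \<phi> u - ?J u *v (v - u)) \<le> \<eta> * norm (v - u)" by (simp add: mult.commute)
  qed
qed

text \<open>The minimum over \<open>K\<close> times the unit sphere is attained, and it is positive
  by invertibility.\<close>

lemma jacobian_lower_bound: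
  obtains c where "0 < c" "\<And>u x. u \<in> K \<Longrightarrow> c * norm x \<le> norm (jacobian \<phi> (at u) *v x)"
proof -
  let ?J = "\<lambda>u. jacobian \<phi> (at u)"
  let ?C = "K \<times> sphere (0::real^'n) 1" and ?g = "\<lambda>z. norm (?J (fst z) *v snd z)"
  have "compact ?C" by (intro compact_Times compact_K) auto
  moreover have "?C \<noteq> {}"
    using K_nonempty by (auto simp: sphere_eq_empty)
  moreover have "continuous_on ?C ?g"
  proof -
    have "continuous_on ?C (\<lambda>z. ?J (fst z))"
      using K_subset by (intro continuous_on_compose2[OF continuous_jacobian]) (auto intro!: continuous_intros)
    then show ?thesis unfolding matrix_vector_mult_def by (intro continuous_intros)
  qed
  ultimately obtain z where z: "z \<in> ?C" "\<And>y. y \<in> ?C \<Longrightarrow> ?g z \<le> ?g y"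
    using continuous_attains_inf[of ?C ?g] by blast
  have zK: "fst z \<in> U" "snd z \<noteq> 0" using z(1) K_subset by auto
  show thesis
  proof
    show "0 < ?g z"
      using invertible_matrix_vector_eq_0[OF invertible_jacobian[OF zK(1)]] zK(2) by auto
    fix u x assume u: "u \<in> K"
    show "?g z * norm x \<le> norm (?J u *v x)"
    proof (cases "x = 0")
      case False
      then have "?g z \<le> ?g (u, x /\<^sub>R norm x)" using u by (intro z(2)) auto
      then show ?thesis using False by (simp add: matrix_vector_mult_scaleR field_simps)
    qed simp
  qed
qed

lemma lsv_iterate_le:
  fixes S :: "real^'n^'n"
  assumes S: "invertible S" and d: "0 \<le> d" "d \<le> real CARD('n)"
    and bound: "\<And>u. u \<in> K \<Longrightarrow> lsv d (S ** jacobian \<phi> (at u) ** matrix_inv S) + (V (\<phi> u) - V u) \<le> - \<epsilon>"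
    and u: "u \<in> K"
  shows "lsv d (S ** jacobian (\<phi> ^^ t) (at u) ** matrix_inv S) + (V ((\<phi> ^^ t) u) - V u) \<le> - \<epsilon> * real t"
proof (induction t)
  case 0
  have "lsv d (mat 1 :: real^'n^'n) \<le> d * ln 1"
    using d by (intro lsv_le) (auto simp: invertible_def intro: exI[of _ "mat 1"])
  then show ?case using invertible_matrix_inv(1)[OF S] by (simp add: jacobian_id[unfolded id_def])
next
  case (Suc t)
  let ?x = "(\<phi> ^^ t) u" and ?I = "matrix_inv S"
  let ?A = "jacobian \<phi> (at ?x)" and ?B = "jacobian (\<phi> ^^ t) (at u)"
  have x: "?x \<in> K" by (rule iterate_in_K[OF u])
  have I: "invertible ?I" using invertible_matrix_inv[OF S] by (auto simp: invertible_def)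
  have inv: "invertible ?A" "invertible ?B"
    using x u K_subset invertible_jacobian smooth_system.invertible_jacobian[OF iterate] by auto
  \<comment> \<open>Inserting \<open>?I ** S\<close> turns the chain rule into a product of
    conjugates, so \<open>bound\<close> applies to the first factor at the orbit point
    \<open>?x\<close>.\<close>
  have "S ** jacobian (\<phi> ^^ Suc t) (at u) ** ?I = (S ** ?A ** ?I) ** (S ** ?B ** ?I)"
  proof -
    have "(S ** ?A ** ?I) ** (S ** ?B ** ?I) = S ** ?A ** (?I ** S) ** ?B ** ?I"
      by (simp only: matrix_mul_assoc)
    also have "\<dots> = S ** (?A ** ?B) ** ?I"
      by (simp add: invertible_matrix_inv(2)[OF S] matrix_mul_assoc)
    finally show ?thesis using jacobian_iterate_Suc[of u t] u K_subset by auto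
  qed
  also have "lsv d \<dots> \<le> lsv d (S ** ?A ** ?I) + lsv d (S ** ?B ** ?I)"
    using S I inv by (intro lsv_mult_le invertible_mult d)
  finally show ?case using Suc bound[OF x] by (simp add: algebra_simps comp_def)
qed

lemma hausdorff_measure_eq_0:
  assumes d: "0 < d" "d < real CARD('n)" and neg: "\<And>u. u \<in> K \<Longrightarrow> lsv d (jacobian \<phi> (at u)) < 0"
  shows "hausdorff_measure d K = 0"
proof -
  let ?n = "real CARD('n)"
  have d': "0 \<le> d" "d \<le> ?n" using d by auto
  have cont: "continuous_on K (\<lambda>u. jacobian \<phi> (at u))"
    using continuous_jacobian K_subset by (rule continuous_on_subset)
  obtain \<kappa> where \<kappa>: "\<kappa> < 0" "\<And>u. u \<in> K \<Longrightarrow> lsv d (jacobian \<phi> (at u)) \<le> \<kappa>"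
    using lsv_uniform_negative[OF compact_K cont _ d' neg] invertible_jacobian K_subset by blast
  \<comment> \<open>The constant of \<open>ellipsoid_net\<close> times \<open>2 powr d\<close>, the
    cost of doubling the radii when recentring.\<close>
  define C where "C = 2 powr d * 2 ^ CARD('n) * (2 * sqrt ?n) powr d"
  have C: "0 < C" by (simp add: C_def)
  \<comment> \<open>\<open>m1\<close> steps bring the mass factor \<open>C\<close> times omega_d to
    at most 1/2. \<open>m2\<close> steps halve the radius: after recentring it is at most 4 sqrt(n)
    omega_d^(1/d) r, whence the 8.\<close>
  obtain m1 where m1: "exp \<kappa> ^ m1 < 1 / (2 * C)"
    using real_arch_pow_inv[of "1 / (2 * C)" "exp \<kappa>"] C \<kappa>(1) by auto
  obtain m2 where m2: "exp (\<kappa> / d) ^ m2 < 1 / (8 * sqrt ?n)"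
    using real_arch_pow_inv[of "1 / (8 * sqrt ?n)" "exp (\<kappa> / d)"] \<kappa>(1) d by (auto simp: divide_neg_pos)
  define m where "m = m1 + m2"
  define G where "G = \<phi> ^^ m"
  interpret G: smooth_system G U K unfolding G_def by (rule iterate)
  let ?J = "\<lambda>u. jacobian G (at u)"
  have lsvG: "lsv d (?J u) \<le> \<kappa> * real m" if u: "u \<in> K" for u
  proof -
    have I: "invertible (mat 1 :: real^'n^'n)" by (auto simp: invertible_def intro: exI[of _ "mat 1"])
    have "matrix_inv (mat 1) = (mat 1 :: real^'n^'n)" using invertible_matrix_inv[OF I] by simp
    then show ?thesis
      using lsv_iterate_le[OF I d' _ u, of "\<lambda>_. 0" "- \<kappa>" m] \<kappa>(2) by (simp add: G_def)
  qed
  obtain c where c: "0 < c" "\<And>u x. u \<in> K \<Longrightarrow> c * norm x \<le> norm (?J u *v x)"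
    by (rule G.jacobian_lower_bound) metis
  \<comment> \<open>The linearisation error is measured against \<open>c\<close>, the lower bound on
    the expansion of \<open>G\<close>, as \<open>ellipsoid_net\<close> requires.\<close>
  obtain r0 where r0: "0 < r0" "\<And>u v. u \<in> K \<Longrightarrow> dist u v \<le> r0 \<Longrightarrow>
    norm (G v - G u - ?J u *v (v - u)) \<le> c * norm (v - u)"
    using G.linearization[OF c(1)] by metis
  show ?thesis
  proof (rule hausdorff_measure_eq_0_by_contraction[OF compact_K _ d(1) r0(1), of G])
    show "K \<subseteq> G ` K" using G.invariant by simp
    fix p r assume p: "p \<in> K" and r: "0 < r" "r \<le> r0"
    have inv: "invertible (?J p)" using G.invertible_jacobian K_subset p by auto
    obtain P R where P: "finite P" "0 < R"
      "real (card P) * R powr d \<le> 2 ^ CARD('n) * (2 * sqrt ?n) powr d * exp (lsv d (?J p)) * r powr d"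
      "R \<le> 2 * sqrt ?n * exp (lsv d (?J p) / d) * r"
      "\<And>x y. norm x \<le> r \<Longrightarrow> norm (y - G p - ?J p *v x) \<le> c * r \<Longrightarrow> \<exists>p\<in>P. dist y p \<le> R"
      using ellipsoid_net[OF inv d less_imp_le[OF c(1)] c(2)[OF p] r(1), of "G p"] by metis
    have cover: "\<exists>q\<in>P. dist y q \<le> R" if y: "y \<in> G ` (K \<inter> cball p r)" for y
    proof -
      obtain v where v: "v \<in> K" "norm (v - p) \<le> r" "y = G v"
        using y by (auto simp: dist_norm norm_minus_commute)
      have "norm (G v - G p - ?J p *v (v - p)) \<le> c * norm (v - p)"
        using v r by (intro r0(2)[OF p]) (simp add: dist_norm norm_minus_commute)
      also have "\<dots> \<le> c * r" using v(2) c(1) by simp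
      finally show ?thesis using P(5)[OF v(2)] v(3) by blast
    qed
    have "G ` (K \<inter> cball p r) \<subseteq> K" using G.invariant by blast
    from recentre_net[OF P(1) this cover] obtain Q where Q: "finite Q" "Q \<subseteq> K" "card Q \<le> card P"
      "G ` (K \<inter> cball p r) \<subseteq> (\<Union>q\<in>Q. cball q (2 * R))" by metis
    have "real (card Q) * (2 * R) powr d \<le> real (card P) * (2 * R) powr d"
      using Q(3) by (intro mult_right_mono) auto
    also have "\<dots> = 2 powr d * (real (card P) * R powr d)" using P(2) by (simp add: powr_mult)
    also have "\<dots> \<le> 2 powr d * (2 ^ CARD('n) * (2 * sqrt ?n) powr d * exp (lsv d (?J p)) * r powr d)"
      using P(3) by (intro mult_left_mono) auto
    also have "\<dots> = C * exp (lsv d (?J p)) * r powr d" by (simp add: C_def)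
    also have "\<dots> \<le> (1 / 2) * r powr d"
    proof (intro mult_right_mono)
      have "exp (lsv d (?J p)) \<le> exp \<kappa> ^ m"
        using lsvG[OF p] by (simp add: mult.commute flip: exp_of_nat_mult)
      also have "\<dots> \<le> exp \<kappa> ^ m1" unfolding m_def using \<kappa>(1) by (intro power_decreasing) auto
      finally have "exp (lsv d (?J p)) \<le> 1 / (2 * C)" using m1 by simp
      then show "C * exp (lsv d (?J p)) \<le> 1 / 2" using C by (simp add: field_simps)
    qed auto
    finally have card: "real (card Q) * (2 * R) powr d \<le> r powr d / 2" by simp
    have "lsv d (?J p) / d \<le> real m * (\<kappa> / d)"
      using lsvG[OF p] d by (simp add: field_simps)
    then have "exp (lsv d (?J p) / d) \<le> exp (\<kappa> / d) ^ m" by (simp flip: exp_of_nat_mult)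
    also have "\<dots> \<le> exp (\<kappa> / d) ^ m2"
      unfolding m_def using \<kappa>(1) d by (intro power_decreasing) (auto simp: divide_nonpos_pos)
    finally have "exp (lsv d (?J p) / d) \<le> 1 / (8 * sqrt ?n)" using m2 by simp
    then have "2 * sqrt ?n * exp (lsv d (?J p) / d) * r \<le> 2 * sqrt ?n * (1 / (8 * sqrt ?n)) * r"
      using r by (intro mult_right_mono mult_left_mono) auto
    then have "2 * R \<le> r / 2" using P(4) by simp
    then show "\<exists>Q R. finite Q \<and> Q \<subseteq> K \<and> 0 < R \<and> R \<le> r / 2
       \<and> real (card Q) * R powr d \<le> r powr d / 2 \<and> G ` (K \<inter> cball p r) \<subseteq> (\<Union>q\<in>Q. cball q R)"
      using Q card P(2) by (intro exI[of _ Q] exI[of _ "2 * R"]) auto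
  qed
qed

section \<open>From local estimates to the dimension inequalities\<close>

lemma local_le_lyapunov_dim: "u \<in> K \<Longrightarrow> local_lyapunov_dim \<phi> u \<le> lyapunov_dim \<phi> K"
  unfolding lyapunov_dim_def using local_lyapunov_dim_bounds(2)[of \<phi>]
  by (intro cSUP_upper bdd_aboveI[of _ "real CARD('n)"]) auto

lemma lyapunov_dim_nonneg: "0 \<le> lyapunov_dim \<phi> K"
  using K_nonempty local_le_lyapunov_dim local_lyapunov_dim_bounds(1)[of \<phi>] by (meson all_not_in_conv order_trans)

lemma lyapunov_dim_leI: "(\<And>u. u \<in> K \<Longrightarrow> local_lyapunov_dim \<phi> u \<le> d) \<Longrightarrow> lyapunov_dim \<phi> K \<le> d"
  unfolding lyapunov_dim_def using K_nonempty by (intro cSUP_least)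

text \<open>It suffices to find measure zero in some dimension at most d for every d above the
  Lyapunov dimension. If the latter is below n, an exponent strictly between it and min d n admits
  the covering argument; otherwise d > n and boundedness of \<open>K\<close> suffices.\<close>

theorem hausdorff_dim_le_lyapunov_dim: "hausdorff_dim K \<le> ereal (lyapunov_dim \<phi> K)"
proof (rule dense_ge)
  fix x :: ereal assume "ereal (lyapunov_dim \<phi> K) < x"
  then obtain d where d: "lyapunov_dim \<phi> K < d" "ereal d \<le> x"
    by (metis ereal_dense2 ereal_less(2) less_ereal.simps(1) less_imp_le)
  let ?n = "real CARD('n)"
  have "\<exists>d'. 0 \<le> d' \<and> d' \<le> d \<and> hausdorff_measure d' K = 0"
  proof (cases "lyapunov_dim \<phi> K < ?n")
    case True
    then obtain d' where d': "lyapunov_dim \<phi> K < d'" "d' < min d ?n"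
      using dense[of "lyapunov_dim \<phi> K" "min d ?n"] d(1) by auto
    have "hausdorff_measure d' K = 0"
    proof (rule hausdorff_measure_eq_0)
      fix u assume u: "u \<in> K"
      show "lsv d' (jacobian \<phi> (at u)) < 0"
        using local_le_lyapunov_dim[OF u] d' u K_subset
        by (intro lsv_negative_if_local_lyapunov_dim_less invertible_jacobian) auto
    qed (use d' lyapunov_dim_nonneg in auto)
    then show ?thesis using d' lyapunov_dim_nonneg by (intro exI[of _ d']) auto
  next
    case False
    then show ?thesis using hausdorff_measure_bounded_eq_0[of K d] compact_K d(1) lyapunov_dim_nonneg
      by (intro exI[of _ d]) (auto intro: compact_imp_bounded)
  qed
  then obtain d' where "0 \<le> d'" "d' \<le> d" "hausdorff_measure d' K = 0" by blast
  then have "hausdorff_dim K \<le> ereal d'" unfolding hausdorff_dim_def by (intro INF_lower) auto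
  also have "\<dots> \<le> x" using \<open>d' \<le> d\<close> d(2) by (meson ereal_less_eq(3) order_trans)
  finally show "hausdorff_dim K \<le> x" .
qed

lemma system_lyapunov_dim_le: "0 < t \<Longrightarrow> system_lyapunov_dim \<phi> K \<le> lyapunov_dim (\<phi> ^^ t) K"
  unfolding system_lyapunov_dim_def using smooth_system.lyapunov_dim_nonneg[OF iterate]
  by (intro cINF_lower bdd_belowI[of _ 0]) auto

theorem hausdorff_dim_le_system_lyapunov_dim: "hausdorff_dim K \<le> ereal (system_lyapunov_dim \<phi> K)"
proof (rule ccontr)
  assume "\<not> hausdorff_dim K \<le> ereal (system_lyapunov_dim \<phi> K)"
  then obtain d where d: "system_lyapunov_dim \<phi> K < d" "ereal d < hausdorff_dim K"
    by (metis ereal_dense2 less_ereal.simps(1) not_le)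
  from d(1) obtain t where "lyapunov_dim (\<phi> ^^ t) K < d"
    unfolding system_lyapunov_dim_def using cInf_lessD[of "(\<lambda>t. lyapunov_dim (\<phi> ^^ t) K) ` {0<..}" d] by auto
  then have "ereal (lyapunov_dim (\<phi> ^^ t) K) < ereal d" by simp
  then show False
    using smooth_system.hausdorff_dim_le_lyapunov_dim[OF iterate, of t] d(2) by (meson less_le_not_le order_trans not_le)
qed

text \<open>Local dimensions below d could still have supremum d. The uniform
  \<open>\<kappa>\<close> and \<open>lsv_shift\<close> provide one gap \<open>\<delta>\<close> valid
  at all points of \<open>K\<close>.\<close>

lemma lyapunov_dim_less:
  assumes d: "0 < d" "d \<le> real CARD('n)" and \<kappa>: "\<kappa> < 0" "\<And>u. u \<in> K \<Longrightarrow> lsv d (jacobian \<phi> (at u)) \<le> \<kappa>"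
  shows "lyapunov_dim \<phi> K < d"
proof -
  obtain c where c: "0 < c" "\<And>u x. u \<in> K \<Longrightarrow> c * norm x \<le> norm (jacobian \<phi> (at u) *v x)"
    by (rule jacobian_lower_bound) metis
  \<comment> \<open>Chosen so that lowering d by \<open>\<delta>\<close> costs at most half of the
    margin \<open>- \<kappa>\<close>; the minimum with d keeps the exponent nonnegative.\<close>
  define \<delta> where "\<delta> = min d (- \<kappa> / (2 * (\<bar>ln c\<bar> + 1)))"
  have \<delta>: "0 < \<delta>" "\<delta> \<le> d" using d \<kappa>(1) by (auto simp: \<delta>_def divide_neg_pos add_nonneg_pos)
  have "\<delta> \<le> - \<kappa> / (2 * (\<bar>ln c\<bar> + 1))" by (simp add: \<delta>_def)
  then have "\<delta> * (\<bar>ln c\<bar> + 1) \<le> - \<kappa> / 2"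
    by (subst (asm) pos_le_divide_eq) (auto simp: algebra_simps)
  moreover have "- ln c * \<delta> \<le> (\<bar>ln c\<bar> + 1) * \<delta>" using \<delta>(1) by (intro mult_right_mono) auto
  ultimately have *: "- (\<delta> * ln c) \<le> - \<kappa> / 2" by (simp add: mult.commute)
  have "lyapunov_dim \<phi> K \<le> d - \<delta>"
  proof (rule lyapunov_dim_leI)
    fix u assume u: "u \<in> K"
    have "lsv (d - \<delta>) (jacobian \<phi> (at u)) \<le> lsv d (jacobian \<phi> (at u)) - (d - (d - \<delta>)) * ln c"
      using \<delta> d by (intro lsv_shift[OF c(1) c(2)[OF u]]) auto
    then have "lsv (d - \<delta>) (jacobian \<phi> (at u)) < 0" using * \<kappa>(1) \<kappa>(2)[OF u] by simp
    then show "local_lyapunov_dim \<phi> u \<le> d - \<delta>"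
      using u K_subset \<delta> d by (intro local_lyapunov_dim_le invertible_jacobian) auto
  qed
  then show ?thesis using \<delta>(1) by simp
qed

end

theorem theorem2:
  fixes \<phi> :: "real^'n \<Rightarrow> real^'n" and U K :: "(real^'n) set"
    and V :: "real^'n \<Rightarrow> real" and S :: "real^'n^'n" and j :: nat and s :: real
  assumes "open U" and "\<phi> ` U \<subseteq> U"
    and "\<phi> differentiable_on U" and "continuous_on U (\<lambda>u. jacobian \<phi> (at u))"
    and "\<And>u. u \<in> U \<Longrightarrow> det (jacobian \<phi> (at u)) \<noteq> 0"
    and "K \<subseteq> U" and "K \<noteq> {}" and "compact K"
    and "\<And>t. t > 0 \<Longrightarrow> (\<phi> ^^ t) ` K = K"
    and "1 \<le> j" and "j < CARD('n)" and "0 \<le> s" and "s \<le> 1"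
    and "continuous_on K V" and "invertible S"
    and "(SUP u\<in>K. ereal (
            (\<Sum>i = 1..j. ln (singular_value (S ** jacobian \<phi> (at u) ** matrix_inv S) i))
            + s * ln (singular_value (S ** jacobian \<phi> (at u) ** matrix_inv S) (j + 1))
            + (V (\<phi> u) - V u))) < 0"
  shows "\<exists>T\<^sub>0>0. \<forall>T\<ge>T\<^sub>0.
           hausdorff_dim K \<le> ereal (system_lyapunov_dim \<phi> K) \<and>
           system_lyapunov_dim \<phi> K \<le> lyapunov_dim (\<phi> ^^ T) K \<and>
           lyapunov_dim (\<phi> ^^ T) K < real j + s"
proof -
  interpret smooth_system \<phi> U K
    using assms(1-8) assms(9)[of 1] by unfold_locales (auto simp: invertible_det_nz)
  let ?d = "real j + s" and ?I = "matrix_inv S"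
  have d: "0 < ?d" "?d \<le> real CARD('n)" "0 \<le> ?d" using assms(10-13) by auto
  \<comment> \<open>The supremum is extended real and could be minus infinity as far as its type
    goes; a real number strictly between it and 0 yields the rate \<open>\<epsilon>\<close>.\<close>
  obtain r where r: "(SUP u\<in>K. ereal (
            (\<Sum>i = 1..j. ln (singular_value (S ** jacobian \<phi> (at u) ** ?I) i))
            + s * ln (singular_value (S ** jacobian \<phi> (at u) ** ?I) (j + 1))
            + (V (\<phi> u) - V u))) < ereal r" "ereal r < 0"
    using ereal_dense2[OF assms(16)] by blast
  define \<epsilon> where "\<epsilon> = - r"
  have \<epsilon>: "0 < \<epsilon>" using r(2) by (simp add: \<epsilon>_def)
  have bound: "lsv ?d (S ** jacobian \<phi> (at u) ** ?I) + (V (\<phi> u) - V u) \<le> - \<epsilon>" if u: "u \<in> K" for u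
  proof -
    have "ereal ((\<Sum>i = 1..j. ln (singular_value (S ** jacobian \<phi> (at u) ** ?I) i))
            + s * ln (singular_value (S ** jacobian \<phi> (at u) ** ?I) (j + 1))
            + (V (\<phi> u) - V u)) < ereal r"
      using r(1) SUP_upper[OF u] by (rule le_less_trans[rotated])
    then show ?thesis using lsv_eq[of s j "S ** jacobian \<phi> (at u) ** ?I"] assms(11-13) by (simp add: \<epsilon>_def)
  qed
  have "bounded (V ` K)" using assms(8,14) compact_continuous_image compact_imp_bounded by blast
  then obtain M where M: "\<And>u. u \<in> K \<Longrightarrow> \<bar>V u\<bar> \<le> M" by (auto simp: bounded_iff)
  have I: "invertible ?I" using invertible_matrix_inv[OF assms(15)] by (auto simp: invertible_def)
  \<comment> \<open>The price, independent of time, of undoing the conjugation by \<open>S\<close>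
    and of the telescoped difference of \<open>V\<close>, at most \<open>2 * M\<close>.\<close>
  define C where "C = lsv ?d ?I + lsv ?d S + 2 * M"
  have iter: "lsv ?d (jacobian (\<phi> ^^ t) (at u)) \<le> C - \<epsilon> * real t" if u: "u \<in> K" for u t
  proof -
    let ?A = "jacobian (\<phi> ^^ t) (at u)"
    have A: "invertible ?A"
      using u K_subset smooth_system.invertible_jacobian[OF iterate] by auto
    have "?I ** (S ** ?A ** ?I) ** S = (?I ** S) ** ?A ** (?I ** S)"
      by (simp only: matrix_mul_assoc)
    then have eq: "?A = ?I ** (S ** ?A ** ?I) ** S"
      by (simp add: invertible_matrix_inv(2)[OF assms(15)])
    have "lsv ?d ?A \<le> lsv ?d (?I ** (S ** ?A ** ?I)) + lsv ?d S"
      by (subst eq, intro lsv_mult_le invertible_mult I A assms(15) d)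
    also have "lsv ?d (?I ** (S ** ?A ** ?I)) \<le> lsv ?d ?I + lsv ?d (S ** ?A ** ?I)"
      by (intro lsv_mult_le invertible_mult I A assms(15) d)
    also have "lsv ?d (S ** ?A ** ?I) \<le> - \<epsilon> * real t - (V ((\<phi> ^^ t) u) - V u)"
      using lsv_iterate_le[OF assms(15) d(3,2) bound u, of t] by simp
    also have "\<dots> \<le> - \<epsilon> * real t + 2 * M"
      using M[OF u] M[OF iterate_in_K[OF u, of t]] by simp
    finally show ?thesis by (simp add: C_def)
  qed
  \<comment> \<open>Beyond \<open>C / \<epsilon>\<close> the linear decay outweighs
    \<open>C\<close>, giving a negative bound uniform in u.\<close>
  obtain T0 :: nat where T0: "C / \<epsilon> < real T0" using reals_Archimedean2 by blast
  show ?thesis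
  proof (intro exI[of _ "Suc T0"] conjI allI impI)
    fix T assume T: "Suc T0 \<le> T"
    show "hausdorff_dim K \<le> ereal (system_lyapunov_dim \<phi> K)"
      by (rule hausdorff_dim_le_system_lyapunov_dim)
    show "system_lyapunov_dim \<phi> K \<le> lyapunov_dim (\<phi> ^^ T) K"
      using T by (intro system_lyapunov_dim_le) auto
    have "C / \<epsilon> < real T" using T0 T by linarith
    then have "C - \<epsilon> * real T < 0" using \<epsilon> by (simp add: field_simps)
    then show "lyapunov_dim (\<phi> ^^ T) K < ?d"
      using iter d by (intro smooth_system.lyapunov_dim_less[OF iterate]) auto
  qed simp
qed

end
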